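(* Let $X,Y$ be Hilbert spaces, $F:X\to Y$ a bounded linear operator, and $u_0\in X$. For $T>0$ let $R_T:Y\to X$ be the operator defined in the context. Then $R_T$ is a regularization operator for the equation $Fu=y$ (as $T\to\infty$) with qualification $\mu_0=\infty$, i.e. it satisfies the following for every $\mu>0$. (i) If the data are exact, $y=Fu^\dagger$, and $u^\dagger\in X$ satisfies the source condition $$\exists\,\omega\in X:\quad u^\dagger=(F^*F)^\mu\omega ,$$ then $u_T:=R_T(y)$ satisfies $$\|u_T-u^\dagger\|\le C_\mu T^{-2\mu},$$ with a constant $C_\mu$ independent of $T$. (ii) If the data are contaminated with noise, $\|y-y_\delta\|\le\delta$, where $y=Fu^\dagger$ with $u^\dagger$ satisfying the same source condition $u^\dagger=(F^*F)^\mu\omega$ for some $\omega\in X$, then $u_{T,\delta}:=R_T(y_\delta)$ satisfies $$\|u_{T,\delta}-u^\dagger\|\le C_\mu T^{-2\mu}+\delta T .$$ In particular, the a-priori parameter choice $T\sim\delta^{-\frac{1}{2\mu+1}}$ yields the optimal order convergence rate $$\|u_{T,\delta}-u^\dagger\|=O\big(\delta^{\frac{2\mu}{2\mu+1}}\big)\qquad\text{as }\delta\to0.$$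
   Context: Definition of $R_T$. The element $u_0\in X$ is any initial approximation of the minimum norm solution $u^\dagger$ of $Fu=y$. For fixed $T>0$ let $Q:[0,T]\to L(Y,Y)$ (bounded linear operators on $Y$) be the solution of the operator Riccati equation $$Q'(t)=-I+Q(t)FF^*Q(t),\quad t\in[0,T],\qquad Q(T)=0 .$$ For $y\in Y$ let $\bar u:[0,T]\to X$ be the solution of $$\bar u'(t)=-F^*Q(t)\,[F\bar u(t)-y],\qquad \bar u(0)=u_0 ,$$ and set $$R_T(y):=\bar u(T)=u_0-\int_0^T F^*Q(t)[F\bar u(t)-y]\,dt .$$ (Both $Q$ and $\bar u$ depend on $T$.) The powers $(F^*F)^\mu$ are defined by the spectral calculus. The notation $T\sim\delta^{-1/(2\mu+1)}$ means $c_1\delta^{-1/(2\mu+1)}\le T\le c_2\delta^{-1/(2\mu+1)}$ with constants $c_1,c_2>0$. Regularization operator (standard notion from the theory of linear inverse problems): a family of continuous maps $R_T:Y\to X$, $T>0$, is a regularization operator for $Fu=y$ as $T\to\infty$ if for every $y$ in the domain $\mathcal R(F)\oplus\mathcal R(F)^\perp$ of the Moore–Penrose inverse $F^\dagger$ there is a parameter choice rule $T=T(\delta,y_\delta)$ such that, as $\delta\to0$, $\sup\{\|R_{T(\delta,y_\delta)}(y_\delta)-F^\dagger y\|: \|y_\delta-y\|\le\delta\}\to0$ and $\inf\{T(\delta,y_\delta):\|y_\delta-y\|\le\delta\}\to\infty$. Qualification $\mu_0=\infty$ means that the rates in (i) and (ii) hold for all $\mu>0$, without saturation.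
   Formalization: As printed the claim fails (F=0, u_0≠0 gives R_T(y)=u_0 but u†=0); here the source condition in (i), (ii) and the rate is imposed on u†−u_0 instead of u†, and the regularization property is proved for u_0 orthogonal to the null space of F. *)

theory Defs
  imports "HOL-Analysis.Analysis" "HOL-Computational_Algebra.Polynomial"
begin

text \<open>Hilbert spaces are types of sort \<open>{real_inner, complete_space}\<close>. A complex Hilbert space
  is covered through its real inner product \<open>Re \<langle>x, y\<rangle>\<close>, which has the same norm and
  yields the same adjoints.\<close>

text \<open>\<^const>\<open>adjoint\<close> is a choice; existence and boundedness of the adjoint of a bounded operator
  between Hilbert spaces rest on the Riesz representation theorem.\<close>

definition adj ::
  "('x::{real_inner,complete_space} \<Rightarrow>\<^sub>L 'y::{real_inner,complete_space}) \<Rightarrow> ('y \<Rightarrow>\<^sub>L 'x)" where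
  "adj F = Blinfun (adjoint (blinfun_apply F))"


subsection \<open>Spectral calculus and fractional powers\<close>

definition op_spectrum :: "('x::real_normed_vector \<Rightarrow>\<^sub>L 'x) \<Rightarrow> real set" where
  "op_spectrum A = {l. \<not> (\<exists>B. (A - l *\<^sub>R id_blinfun) o\<^sub>L B = id_blinfun \<and>
                              B o\<^sub>L (A - l *\<^sub>R id_blinfun) = id_blinfun)}"

definition op_pow :: "('x::real_normed_vector \<Rightarrow>\<^sub>L 'x) \<Rightarrow> nat \<Rightarrow> ('x \<Rightarrow>\<^sub>L 'x)" where
  "op_pow A n = (((o\<^sub>L) A) ^^ n) id_blinfun"

definition op_poly :: "real poly \<Rightarrow> ('x::real_normed_vector \<Rightarrow>\<^sub>L 'x) \<Rightarrow> ('x \<Rightarrow>\<^sub>L 'x)" where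
  "op_poly p A = (\<Sum>i\<le>degree p. coeff p i *\<^sub>R op_pow A i)"

text \<open>Continuous functional calculus of a bounded self-adjoint operator \<open>A\<close>: \<open>f(A)\<close> is the
  operator-norm limit of \<open>p\<^sub>n(A)\<close> for polynomials \<open>p\<^sub>n\<close> that converge to \<open>f\<close> uniformly on the
  spectrum of \<open>A\<close>; it does not depend on the approximating sequence.\<close>

definition op_fun ::
  "(real \<Rightarrow> real) \<Rightarrow> ('x::{real_inner,complete_space} \<Rightarrow>\<^sub>L 'x) \<Rightarrow> ('x \<Rightarrow>\<^sub>L 'x)" where
  "op_fun f A = (THE B. \<exists>p :: nat \<Rightarrow> real poly.
      uniform_limit (op_spectrum A) (\<lambda>n. poly (p n)) f sequentially \<and>
      (\<lambda>n. op_poly (p n) A) \<longlonglongrightarrow> B)"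

text \<open>Intended for positive self-adjoint \<open>A\<close> and \<open>\<mu> > 0\<close>; then \<open>x powr \<mu>\<close> is continuous on the
  spectrum, with \<open>0 powr \<mu> = 0\<close>.\<close>

definition op_powr ::
  "('x::{real_inner,complete_space} \<Rightarrow>\<^sub>L 'x) \<Rightarrow> real \<Rightarrow> ('x \<Rightarrow>\<^sub>L 'x)" where
  "op_powr A \<mu> = op_fun (\<lambda>x. x powr \<mu>) A"

definition source_condition ::
  "('x::{real_inner,complete_space} \<Rightarrow>\<^sub>L 'y::{real_inner,complete_space}) \<Rightarrow> real \<Rightarrow> 'x \<Rightarrow> bool" where
  "source_condition F \<mu> v \<longleftrightarrow> (\<exists>\<omega>. v = op_powr (adj F o\<^sub>L F) \<mu> \<omega>)"


subsection \<open>The Moore--Penrose inverse and regularization operators\<close>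

definition least_squares_solution ::
  "('x::{real_inner,complete_space} \<Rightarrow>\<^sub>L 'y::{real_inner,complete_space}) \<Rightarrow> 'y \<Rightarrow> 'x \<Rightarrow> bool" where
  "least_squares_solution F y u \<longleftrightarrow> (\<forall>v. norm (F u - y) \<le> norm (F v - y))"

definition mp_domain ::
  "('x::{real_inner,complete_space} \<Rightarrow>\<^sub>L 'y::{real_inner,complete_space}) \<Rightarrow> 'y set" where
  "mp_domain F = {a + b | a b. a \<in> range (blinfun_apply F) \<and> b \<in> (range (blinfun_apply F))\<^sup>\<bottom>}"

definition mp_inverse ::
  "('x::{real_inner,complete_space} \<Rightarrow>\<^sub>L 'y::{real_inner,complete_space}) \<Rightarrow> 'y \<Rightarrow> 'x" where
  "mp_inverse F y = (THE u. least_squares_solution F y u \<and>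
      (\<forall>v. least_squares_solution F y v \<longrightarrow> norm u \<le> norm v))"

text \<open>The supremum and the infimum are taken in \<^typ>\<open>ereal\<close>, where they exist unconditionally.\<close>

definition regularization_operator ::
  "('x::{real_inner,complete_space} \<Rightarrow>\<^sub>L 'y::{real_inner,complete_space}) \<Rightarrow>
   (real \<Rightarrow> 'y \<Rightarrow> 'x) \<Rightarrow> bool" where
  "regularization_operator F R \<longleftrightarrow>
     (\<forall>T>0. continuous_on UNIV (R T)) \<and>
     (\<forall>y \<in> mp_domain F. \<exists>T :: real \<Rightarrow> 'y \<Rightarrow> real.
        (\<forall>\<delta>>0. \<forall>z. T \<delta> z > 0) \<and>
        ((\<lambda>\<delta>. SUP z \<in> {z. norm (z - y) \<le> \<delta>}. ereal (norm (R (T \<delta> z) z - mp_inverse F y)))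
           \<longlongrightarrow> 0) (at_right 0) \<and>
        ((\<lambda>\<delta>. INF z \<in> {z. norm (z - y) \<le> \<delta>}. ereal (T \<delta> z)) \<longlongrightarrow> \<infinity>) (at_right 0))"


subsection \<open>The operator defined by the Riccati equation\<close>

definition riccati_solution ::
  "('x::{real_inner,complete_space} \<Rightarrow>\<^sub>L 'y::{real_inner,complete_space}) \<Rightarrow> real \<Rightarrow>
   (real \<Rightarrow> ('y \<Rightarrow>\<^sub>L 'y)) \<Rightarrow> bool" where
  "riccati_solution F T Q \<longleftrightarrow>
     (\<forall>t \<in> {0..T}. (Q has_vector_derivative
        (- id_blinfun + (Q t o\<^sub>L (F o\<^sub>L adj F) o\<^sub>L Q t))) (at t within {0..T})) \<and>
     Q T = 0"

definition state_solution ::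
  "('x::{real_inner,complete_space} \<Rightarrow>\<^sub>L 'y::{real_inner,complete_space}) \<Rightarrow> 'x \<Rightarrow> real \<Rightarrow> 'y \<Rightarrow>
   (real \<Rightarrow> ('y \<Rightarrow>\<^sub>L 'y)) \<Rightarrow> (real \<Rightarrow> 'x) \<Rightarrow> bool" where
  "state_solution F u0 T y Q u \<longleftrightarrow>
     (\<forall>t \<in> {0..T}. (u has_vector_derivative
        (- adj F (Q t (F (u t) - y)))) (at t within {0..T})) \<and>
     u 0 = u0"

text \<open>For \<open>T > 0\<close> both differential equations are uniquely solvable on \<open>[0, T]\<close>, but their
  solutions are represented by functions on \<^typ>\<open>real\<close> that are arbitrary outside \<open>[0, T]\<close>.
  The description is therefore applied to the value \<open>u(T)\<close>, which is unique.\<close>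

definition riccati_reg ::
  "('x::{real_inner,complete_space} \<Rightarrow>\<^sub>L 'y::{real_inner,complete_space}) \<Rightarrow> 'x \<Rightarrow> real \<Rightarrow> 'y \<Rightarrow> 'x" where
  "riccati_reg F u0 T y =
     (THE v. \<exists>Q u. riccati_solution F T Q \<and> state_solution F u0 T y Q u \<and> v = u T)"

end

theory Submission
  imports Defs "HOL-Computational_Algebra.Fundamental_Theorem_Algebra"
begin

text \<open>
  Write \<open>A = F\<^sup>* F\<close>, \<open>B = F F\<^sup>*\<close> and \<open>r = \<surd>A\<close>. The Riccati equation has the solution
  \<open>Q(t) = tanh ((T - t) \<surd>B) / \<surd>B\<close>, and integrating the linear state equation gives
  \<open>R\<^sub>T y = cosh (T r)\<^sup>-\<^sup>1 (u\<^sub>0 + (cosh (T r) - 1) / r\<^sup>2 (F\<^sup>* y))\<close>. Hence the error is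
  \<open>cosh (T r)\<^sup>-\<^sup>1 (u\<^sub>0 - u)\<close> for exact data, plus a noise term whose operator norm is at most \<open>T\<close>
  because \<open>1 - 1 / cosh x \<le> x\<close>. The bias decays like \<open>T\<^sup>-\<^sup>2\<^sup>\<mu>\<close> under the source condition, since
  \<open>cosh x \<ge> 1 + x\<^sup>2\<^sup>k / (2k)!\<close>, and tends to \<open>0\<close> on the closure of the range of \<open>A\<close>, which contains
  the orthogonal complement of the null space of \<open>F\<close>. All functions of \<open>A\<close> other than the power
  \<open>A\<^sup>\<mu>\<close> are power series in \<open>A\<close>, and operator inequalities between them reduce to comparing
  nonnegative coefficients.
\<close>

section \<open>Hilbert spaces\<close>

text \<open>\<open>op_powr\<close> is a \<open>THE\<close> over polynomial approximations on a real
  spectrum, so every fact about it rests on bounding \<open>norm (op_poly p A)\<close> by the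
  supremum of |p| on \<open>op_spectrum A\<close>. This is shown by contradiction: if s =
  \<open>norm (op_poly p A)\<close> is too large, then s^2 - p^2 is positive on the spectrum, and
  factoring it over the reals makes s^2 - p(A)^2 bounded below, which is impossible at the norm of a
  symmetric operator. The second obstacle is that V \<le> W as quadratic forms does not by itself
  compare \<open>norm (V x)\<close> with \<open>norm (W x)\<close>. Norm estimates go through V^2
  \<le> W^2, hence through products such as vers times cosh, and this is why the positivity lemmas
  carry an extra factor \<open>V\<close>. The bridge from the fractional power to cosh is m^\<mu>
  \<le> 1 + m^k at m = l T^2 with an integer k \<ge> \<mu>; as k may be as large as desired, there
  is no saturation. \<open>riccati_reg\<close> is a \<open>THE\<close> as well: its value requires
  uniqueness for both differential equations besides the explicit solutions.\<close>

lemma parallelogram_law_half: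
  fixes x y :: "'a::real_inner"
  shows "(norm (x - y))\<^sup>2 = 2 * (norm x)\<^sup>2 + 2 * (norm y)\<^sup>2 - 4 * (norm ((1/2) *\<^sub>R (x + y)))\<^sup>2"
  by (simp add: power2_norm_eq_inner inner_simps inner_commute algebra_simps)

text \<open>Near-minimizers are close to each other by the parallelogram law, because their midpoint
  stays in \<open>K\<close>. Serves for the Riesz vector, for the projection onto a closed range and
  for the minimum norm solution.\<close>

lemma closed_convex_min_norm:
  fixes K :: "'a::{real_inner,complete_space} set"
  assumes "closed K" "convex K" "K \<noteq> {}"
  obtains z where "z \<in> K" "\<And>x. x \<in> K \<Longrightarrow> norm z \<le> norm x"
proof -
  define d where "d = (INF x\<in>K. (norm x)\<^sup>2)"
  have bdd: "bdd_below ((\<lambda>x. (norm x)\<^sup>2) ` K)"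
    by (rule bdd_belowI[of _ 0]) auto
  have d_le: "d \<le> (norm x)\<^sup>2" if "x \<in> K" for x
    unfolding d_def using bdd that by (rule cINF_lower)
  have "\<exists>x\<in>K. (norm x)\<^sup>2 < d + inverse (real (Suc n))" for n
    using cINF_less_iff[OF assms(3) bdd, of "d + inverse (real (Suc n))"] by (simp add: d_def)
  then obtain X where X: "\<And>n. X n \<in> K" "\<And>n. (norm (X n))\<^sup>2 < d + inverse (real (Suc n))"
    by metis
  have close: "(norm (X m - X n))\<^sup>2 < 2 * inverse (real (Suc m)) + 2 * inverse (real (Suc n))" for m n
  proof -
    have "(1/2) *\<^sub>R X m + (1/2) *\<^sub>R X n \<in> K"
      using assms(2) X(1) by (intro convexD) auto
    then have "d \<le> (norm ((1/2) *\<^sub>R (X m + X n)))\<^sup>2"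
      using d_le by (simp add: scaleR_add_right)
    then show ?thesis
      using X(2)[of m] X(2)[of n] parallelogram_law_half[of "X m" "X n"] by linarith
  qed
  have "Cauchy X"
  proof (rule CauchyI)
    fix e :: real assume "0 < e"
    then obtain N where N: "inverse (real (Suc N)) < e\<^sup>2 / 4"
      using reals_Archimedean[of "e\<^sup>2 / 4"] by auto
    have "norm (X m - X n) < e" if "m \<ge> N" "n \<ge> N" for m n
    proof (rule power_less_imp_less_base[where n=2])
      have "inverse (real (Suc m)) \<le> inverse (real (Suc N))" "inverse (real (Suc n)) \<le> inverse (real (Suc N))"
        using that by (simp_all add: le_imp_inverse_le)
      then show "(norm (X m - X n))\<^sup>2 < e\<^sup>2" using close[of m n] N by linarith
    qed (use \<open>0 < e\<close> in simp)
    then show "\<exists>M. \<forall>m\<ge>M. \<forall>n\<ge>M. norm (X m - X n) < e" by blast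
  qed
  then obtain z where z: "X \<longlonglongrightarrow> z"
    using Cauchy_convergent convergent_def by blast
  have "z \<in> K" using assms(1) X(1) z closed_sequentially by blast
  have "(norm z)\<^sup>2 \<le> d"
  proof (rule LIMSEQ_le)
    show "(\<lambda>n. (norm (X n))\<^sup>2) \<longlonglongrightarrow> (norm z)\<^sup>2" using z by (intro tendsto_intros)
    show "(\<lambda>n. d + inverse (real (Suc n))) \<longlonglongrightarrow> d"
      using tendsto_add[OF tendsto_const LIMSEQ_inverse_real_of_nat, of d] by simp
    show "\<exists>N. \<forall>n\<ge>N. (norm (X n))\<^sup>2 \<le> d + inverse (real (Suc n))"
      using X(2) less_imp_le by blast
  qed
  then have "norm z \<le> norm x" if "x \<in> K" for x
    using d_le[OF that] by (meson norm_ge_zero order_trans power2_le_imp_le)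
  with \<open>z \<in> K\<close> show ?thesis using that by blast
qed

lemma min_norm_orthogonal:
  fixes z w :: "'a::real_inner"
  assumes "\<And>t. norm z \<le> norm (z + t *\<^sub>R w)"
  shows "z \<bullet> w = 0"
proof (cases "w = 0")
  case False
  \<comment> \<open>The minimizer over t of the squared norm of \<open>z + t *\<^sub>R w\<close>; it
    lowers the value by \<open>(z \<bullet> w)\<^sup>2 / (w \<bullet> w)\<close>.\<close>
  define t where "t = - (z \<bullet> w) / (w \<bullet> w)"
  have "(norm z)\<^sup>2 \<le> (norm (z + t *\<^sub>R w))\<^sup>2"
    using assms[of t] by (simp add: power_mono)
  also have "\<dots> = (norm z)\<^sup>2 - (z \<bullet> w)\<^sup>2 / (w \<bullet> w)"
    unfolding power2_norm_eq_inner using False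
    by (simp add: inner_simps inner_commute t_def power2_eq_square field_simps)
  finally have "(z \<bullet> w)\<^sup>2 / (w \<bullet> w) \<le> 0" by simp
  then show ?thesis
    using False inner_gt_zero_iff[of w] by (auto simp: divide_le_0_iff simp del: inner_gt_zero_iff)
qed simp

text \<open>The uniqueness that evaluates the \<open>THE\<close> in
  \<open>mp_inverse\<close>.\<close>

lemma min_norm_unique:
  fixes z w :: "'a::real_inner"
  assumes "convex K" "z \<in> K" "w \<in> K" "\<And>x. x \<in> K \<Longrightarrow> norm z \<le> norm x" "norm w = norm z"
  shows "w = z"
proof -
  have "(1/2) *\<^sub>R z + (1/2) *\<^sub>R w \<in> K" using assms by (intro convexD) auto
  then have "(norm z)\<^sup>2 \<le> (norm ((1/2) *\<^sub>R (z + w)))\<^sup>2"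
    using assms(4) by (intro power_mono) (simp_all add: scaleR_add_right)
  then have "(norm (z - w))\<^sup>2 \<le> 0"
    using parallelogram_law_half[of z w] assms(5) by simp
  then show ?thesis by simp
qed

text \<open>A nonzero functional is represented by a multiple of the minimum norm element of its
  hyperplane at level 1, since that element is orthogonal to the kernel.\<close>

lemma riesz_representation:
  fixes f :: "'a::{real_inner,complete_space} \<Rightarrow> real"
  assumes "bounded_linear f"
  obtains z where "\<And>x. f x = z \<bullet> x"
proof (cases "\<exists>x. f x \<noteq> 0")
  case True
  interpret bounded_linear f by fact
  from True obtain x0 where "f x0 \<noteq> 0" by blast
  let ?K = "{x. f x = 1}"
  have "f (x0 /\<^sub>R f x0) = 1" using \<open>f x0 \<noteq> 0\<close> by (simp add: scaleR)
  then have "?K \<noteq> {}" by blast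
  moreover have "convex ?K" by (auto simp: convex_def add scaleR)
  moreover have "closed ?K"
    by (intro closed_Collect_eq continuous_on_const linear_continuous_on) fact
  ultimately obtain z where z: "f z = 1" "\<And>x. f x = 1 \<Longrightarrow> norm z \<le> norm x"
    using closed_convex_min_norm[of ?K] by auto
  have "z \<noteq> 0" using z(1) zero by auto
  have "f x = (z /\<^sub>R (z \<bullet> z)) \<bullet> x" for x
  proof -
    \<comment> \<open>Since \<open>f z = 1\<close>, the vector \<open>x - f x *\<^sub>R z\<close>
      lies in the kernel of \<open>f\<close>, so adding multiples of it stays on the
      hyperplane.\<close>
    have "z \<bullet> (x - f x *\<^sub>R z) = 0"
    proof (rule min_norm_orthogonal)
      fix t
      have "f (z + t *\<^sub>R (x - f x *\<^sub>R z)) = 1" by (simp add: add diff scaleR z(1))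
      then show "norm z \<le> norm (z + t *\<^sub>R (x - f x *\<^sub>R z))" by (rule z(2))
    qed
    then show ?thesis using \<open>z \<noteq> 0\<close> by (simp add: inner_simps field_simps)
  qed
  then show ?thesis using that by blast
next
  case False
  then show ?thesis using that[of 0] by simp
qed

text \<open>\<open>adj\<close> wraps the choices \<open>adjoint\<close> and \<open>Blinfun\<close>.
  Riesz provides a map with the adjoint property, which pins down the first; the bound by
  \<open>norm F\<close> from Cauchy-Schwarz unwraps the second.\<close>

lemma adj_works:
  fixes F :: "'x::{real_inner,complete_space} \<Rightarrow>\<^sub>L 'y::{real_inner,complete_space}"
  shows "F x \<bullet> y = x \<bullet> adj F y"
proof -
  have "\<exists>z. \<forall>x. F x \<bullet> y = x \<bullet> z" for y
  proof -
    have "bounded_linear (\<lambda>x. F x \<bullet> y)"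
      by (rule bounded_linear_compose[OF bounded_linear_inner_left blinfun.bounded_linear_right])
    from riesz_representation[OF this] show ?thesis by (metis inner_commute)
  qed
  then obtain G where G: "\<And>x y. F x \<bullet> y = x \<bullet> G y" by metis
  have adj: "adjoint F = G" by (rule adjoint_unique) (use G in simp)
  have "bounded_linear G"
  proof (rule bounded_linear_intro[where K = "norm F"])
    fix y z and r :: real
    show "G (y + z) = G y + G z" 
      by (rule vector_eq_ldot[THEN iffD1]) (simp add: inner_simps flip: G)
    show "G (r *\<^sub>R y) = r *\<^sub>R G y"
      by (rule vector_eq_ldot[THEN iffD1]) (simp add: inner_simps flip: G)
    have "(norm (G y))\<^sup>2 = F (G y) \<bullet> y" by (simp add: G power2_norm_eq_inner)
    also have "\<dots> \<le> norm (F (G y)) * norm y" by (rule norm_cauchy_schwarz)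
    also have "\<dots> \<le> norm F * norm (G y) * norm y" by (intro mult_right_mono norm_blinfun) simp
    finally have *: "norm (G y) * norm (G y) \<le> (norm y * norm F) * norm (G y)"
      by (simp add: power2_eq_square mult_ac)
    show "norm (G y) \<le> norm y * norm F"
      using * by (cases "G y = 0") (simp_all add: mult_le_cancel_right)
  qed
  then have "adj F y = G y" by (simp add: adj_def adj bounded_linear_Blinfun_apply)
  then show ?thesis by (simp add: G)
qed

lemma adj_works': "adj F y \<bullet> x = y \<bullet> F x"
  by (metis adj_works inner_commute)

text \<open>The library instance requires the codomain to be of class \<open>banach\<close>, which the sort
  \<open>{real_normed_vector, complete_space}\<close> does not entail.\<close>

lemma Cauchy_convergent_blinfun:
  fixes X :: "nat \<Rightarrow> 'a::real_normed_vector \<Rightarrow>\<^sub>L 'b::{real_normed_vector,complete_space}"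
  assumes "Cauchy X"
  shows "convergent X"
proof -
  from assms obtain K where K: "\<And>n. norm (X n) \<le> K"
    using Cauchy_Bseq[OF assms] by (auto simp: Bseq_def)
  have cau: "Cauchy (\<lambda>n. X n x)" for x
    by (rule bounded_linear.Cauchy[OF blinfun.bounded_linear_left assms])
  define L where "L x = lim (\<lambda>n. X n x)" for x
  have L: "(\<lambda>n. X n x) \<longlonglongrightarrow> L x" for x
    unfolding L_def using Cauchy_convergent[OF cau] convergent_LIMSEQ_iff by blast
  have "bounded_linear L"
  proof (rule bounded_linear_intro[where K = K])
    fix x y and r :: real
    show "L (x + y) = L x + L y"
      by (rule LIMSEQ_unique[OF L]) (simp add: blinfun.add_right tendsto_add[OF L L])
    show "L (r *\<^sub>R x) = r *\<^sub>R L x"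
      by (rule LIMSEQ_unique[OF L]) (simp add: blinfun.scaleR_right tendsto_scaleR[OF tendsto_const L])
    have "norm (X n x) \<le> norm x * K" for n
      using norm_blinfun[of "X n" x] mult_right_mono[OF K[of n], of "norm x"]
      by (simp add: mult.commute)
    then show "norm (L x) \<le> norm x * K"
      by (intro LIMSEQ_le_const2[OF tendsto_norm[OF L]]) auto
  qed
  then obtain M where M: "blinfun_apply M = L" by (metis bounded_linear_Blinfun_apply)
  have "X \<longlonglongrightarrow> M"
  proof (rule LIMSEQ_I)
    fix e :: real assume "0 < e"
    then obtain N where N: "\<And>m n. m \<ge> N \<Longrightarrow> n \<ge> N \<Longrightarrow> norm (X m - X n) < e / 2"
      using CauchyD[OF assms, of "e / 2"] by auto
    have "norm (X n - M) < e" if "n \<ge> N" for n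
    proof -
      have "norm (X n - M) \<le> e / 2"
      proof (rule norm_blinfun_bound)
        fix x
        have "norm ((X n - M) x) = norm (X n x - L x)" by (simp add: M blinfun.diff_left)
        also have "\<dots> \<le> e / 2 * norm x"
        proof (rule LIMSEQ_le_const2[OF tendsto_norm[OF tendsto_diff[OF tendsto_const L]]])
          have "norm (X n x - X m x) \<le> e / 2 * norm x" if "m \<ge> N" for m
          proof -
            have "norm (X n x - X m x) = norm ((X n - X m) x)" by (simp add: blinfun.diff_left)
            also have "\<dots> \<le> norm (X n - X m) * norm x" by (rule norm_blinfun)
            also have "\<dots> \<le> e / 2 * norm x"
              using N[OF \<open>n \<ge> N\<close> that] by (intro mult_right_mono) auto
            finally show ?thesis .
          qed
          then show "\<exists>N. \<forall>m\<ge>N. norm (X n x - X m x) \<le> e / 2 * norm x" by blast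
        qed
        finally show "norm ((X n - M) x) \<le> e / 2 * norm x" .
      qed (use \<open>0 < e\<close> in simp)
      then show ?thesis using \<open>0 < e\<close> by simp
    qed
    then show "\<exists>N. \<forall>n\<ge>N. norm (X n - M) < e" by blast
  qed
  then show ?thesis by (auto simp: convergent_def)
qed

lemma summable_blinfun_comparison:
  fixes f :: "nat \<Rightarrow> 'a::real_normed_vector \<Rightarrow>\<^sub>L 'b::{real_normed_vector,complete_space}"
  assumes "summable g" "\<And>n. norm (f n) \<le> g n"
  shows "summable f"
proof -
  have "Cauchy (\<lambda>n. \<Sum>i<n. f i)"
  proof (rule CauchyI')
    fix e :: real assume "0 < e"
    have "Cauchy (\<lambda>n. \<Sum>i<n. g i)"
      using assms(1) by (simp add: summable_iff_convergent convergent_Cauchy)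
    from CauchyD[OF this \<open>0 < e\<close>] obtain N
      where N: "\<And>m n. m \<ge> N \<Longrightarrow> n \<ge> N \<Longrightarrow> norm ((\<Sum>i<m. g i) - (\<Sum>i<n. g i)) < e" by auto
    have "norm ((\<Sum>i<m. f i) - (\<Sum>i<n. f i)) < e" if "m \<ge> N" "n > m" for m n
    proof -
      have split: "(\<Sum>i<n. h i) - (\<Sum>i<m. h i) = (\<Sum>i\<in>{m..<n}. h i)" for h :: "nat \<Rightarrow> 'c::ab_group_add"
        using \<open>n > m\<close> sum.atLeastLessThan_concat[of 0 m n h]
        by (simp add: atLeast0LessThan[symmetric] algebra_simps)
      have "norm ((\<Sum>i<m. f i) - (\<Sum>i<n. f i)) = norm (\<Sum>i\<in>{m..<n}. f i)"
        by (subst norm_minus_commute) (simp add: split)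
      also have "\<dots> \<le> (\<Sum>i\<in>{m..<n}. g i)" by (rule sum_norm_le) (rule assms(2))
      also have "\<dots> = (\<Sum>i<n. g i) - (\<Sum>i<m. g i)" by (simp add: split)
      also have "\<dots> < e" using N[of n m] that by auto
      finally show ?thesis .
    qed
    then show "\<exists>M. \<forall>m\<ge>M. \<forall>n>m. dist (\<Sum>i<m. f i) (\<Sum>i<n. f i) < e"
      by (auto simp: dist_norm)
  qed
  then show ?thesis by (simp add: summable_iff_convergent Cauchy_convergent_blinfun)
qed

text \<open>Lax-Milgram: \<open>S x = y\<close> is the fixed point equation of a damped residual
  step, which is a contraction for a suitable step length \<open>\<tau>\<close>.\<close>

lemma coercive_invertible:
  fixes S :: "'x::{real_inner,complete_space} \<Rightarrow>\<^sub>L 'x"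
  assumes c: "0 < c" and coercive: "\<And>x. c * (norm x)\<^sup>2 \<le> x \<bullet> S x"
  obtains D where "S o\<^sub>L D = id_blinfun" "D o\<^sub>L S = id_blinfun" "norm D \<le> 1 / c"
proof -
  have below: "c * norm x \<le> norm (S x)" for x
  proof -
    have "c * norm x * norm x \<le> norm (S x) * norm x"
      using coercive[of x] norm_cauchy_schwarz[of x "S x"] by (simp add: power2_eq_square mult_ac)
    then show ?thesis by (cases "x = 0") (simp_all add: mult_le_cancel_right)
  qed
  \<comment> \<open>Coercivity forces \<open>c \<le> norm S\<close> except on the zero space; the
    maximum covers that case too.\<close>
  define M where "M = max c (norm S)"
  have M: "0 < M" "c \<le> M" "norm S \<le> M" using c by (auto simp: M_def)
  \<comment> \<open>Minimizes 1 - 2 \<tau> c + \<tau>^2 M^2, the squared contraction factor; the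
    minimum is \<open>k\<^sup>2\<close>.\<close>
  define \<tau> where "\<tau> = c / M\<^sup>2"
  define k where "k = sqrt (1 - c\<^sup>2 / M\<^sup>2)"
  have "c\<^sup>2 \<le> M\<^sup>2" using c M by (intro power_mono) auto
  then have k: "0 \<le> k" "k < 1" "k\<^sup>2 = 1 - c\<^sup>2 / M\<^sup>2" using c M by (auto simp: k_def)
  have "\<exists>!x. x - \<tau> *\<^sub>R (S x - y) = x" for y
  proof (rule banach_fix_type[OF k(1,2)], intro allI)
    fix x x' :: 'x
    define d where "d = x - x'"
    have "(norm (d - \<tau> *\<^sub>R S d))\<^sup>2 = (norm d)\<^sup>2 - 2 * \<tau> * (d \<bullet> S d) + \<tau>\<^sup>2 * (norm (S d))\<^sup>2"
      unfolding power2_norm_eq_inner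
      by (simp add: inner_diff_left inner_diff_right inner_commute[of "S d" d] power2_eq_square
          algebra_simps)
    also have "\<dots> \<le> (norm d)\<^sup>2 - 2 * \<tau> * (c * (norm d)\<^sup>2) + \<tau>\<^sup>2 * (M * norm d)\<^sup>2"
    proof -
      have "norm (S d) \<le> M * norm d"
        using norm_blinfun[of S d] mult_right_mono[OF M(3), of "norm d"] by simp
      then have "\<tau>\<^sup>2 * (norm (S d))\<^sup>2 \<le> \<tau>\<^sup>2 * (M * norm d)\<^sup>2"
        by (intro mult_left_mono power_mono) auto
      moreover have "2 * \<tau> * (c * (norm d)\<^sup>2) \<le> 2 * \<tau> * (d \<bullet> S d)"
        using coercive[of d] c by (intro mult_left_mono) (auto simp: \<tau>_def)
      ultimately show ?thesis by linarith
    qed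
    also have "\<dots> = (k * norm d)\<^sup>2"
      unfolding power_mult_distrib k(3) using M
      by (simp add: \<tau>_def field_simps power2_eq_square)
    finally have "norm (d - \<tau> *\<^sub>R S d) \<le> k * norm d"
      by (rule power2_le_imp_le) (use k in simp)
    then show "dist (x - \<tau> *\<^sub>R (S x - y)) (x' - \<tau> *\<^sub>R (S x' - y)) \<le> k * dist x x'"
      by (simp add: d_def dist_norm blinfun.diff_right algebra_simps)
  qed
  moreover have "\<tau> \<noteq> 0" using c M by (simp add: \<tau>_def)
  ultimately have "\<exists>!x. S x = y" for y by simp
  then obtain G where G: "\<And>y. S (G y) = y" by metis
  have inj: "x = x'" if "S x = S x'" for x x'
    using below[of "x - x'"] c that by (simp add: blinfun.diff_right mult_le_0_iff)
  have "bounded_linear G"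
  proof (rule bounded_linear_intro[where K = "1 / c"])
    show "G (x + y) = G x + G y" for x y by (rule inj) (simp add: G blinfun.add_right)
    show "G (r *\<^sub>R x) = r *\<^sub>R G x" for r x by (rule inj) (simp add: G blinfun.scaleR_right)
    show "norm (G x) \<le> norm x * (1 / c)" for x
      using below[of "G x"] c by (simp add: G field_simps)
  qed
  then obtain D where D: "blinfun_apply D = G" by (metis bounded_linear_Blinfun_apply)
  show ?thesis
  proof
    show "S o\<^sub>L D = id_blinfun" by (rule blinfun_eqI) (simp add: D G)
    show "D o\<^sub>L S = id_blinfun" by (rule blinfun_eqI) (simp add: D G inj)
    show "norm D \<le> 1 / c"
      using below c by (intro norm_blinfun_bound) (simp_all add: D field_simps, metis G)
  qed
qed

interpretation blinfun_compose: bounded_bilinear blinfun_compose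
  by (rule bounded_bilinear_blinfun_compose)

section \<open>Polynomials of a symmetric operator\<close>

lemma op_pow_0 [simp]: "op_pow A 0 = id_blinfun"
  by (simp add: op_pow_def)

lemma op_pow_Suc: "op_pow A (Suc n) = A o\<^sub>L op_pow A n"
  by (simp add: op_pow_def)

lemma blinfun_compose_id [simp]: "A o\<^sub>L id_blinfun = A" "id_blinfun o\<^sub>L A = A"
  by (auto intro!: blinfun_eqI)

lemma blinfun_compose_assoc: "(A o\<^sub>L B) o\<^sub>L C = A o\<^sub>L (B o\<^sub>L C)"
  by (rule blinfun_eqI) simp

lemma op_pow_add: "op_pow A (m + n) = op_pow A m o\<^sub>L op_pow A n"
  by (induction m) (simp_all add: op_pow_Suc blinfun_compose_assoc)

text \<open>Two operators are allowed so that \<open>V\<close> can be \<open>adj F\<close>, which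
  carries functions of \<open>F o\<^sub>L adj F\<close> to functions of
  \<open>adj F o\<^sub>L F\<close>; with \<open>B = A\<close> it is a commutation rule.\<close>

lemma op_pow_intertwine:
  assumes "V o\<^sub>L A = B o\<^sub>L V"
  shows "V o\<^sub>L op_pow A n = op_pow B n o\<^sub>L V"
  by (induction n) (simp_all add: op_pow_Suc flip: blinfun_compose_assoc, simp_all add: assms blinfun_compose_assoc)

lemma norm_op_pow_le: "norm (op_pow A n) \<le> norm A ^ n"
proof (induction n)
  case 0
  then show ?case by (simp add: norm_blinfun_id_le)
next
  case (Suc n)
  have "norm (op_pow A (Suc n)) \<le> norm A * norm (op_pow A n)"
    by (simp add: op_pow_Suc norm_blinfun_compose)
  also have "\<dots> \<le> norm A ^ Suc n" using Suc by (simp add: mult_left_mono)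
  finally show ?case .
qed

lemma op_poly_eq_sum:
  assumes "degree p \<le> n"
  shows "op_poly p A = (\<Sum>i\<le>n. coeff p i *\<^sub>R op_pow A i)"
  unfolding op_poly_def using assms
  by (intro sum.mono_neutral_left) (auto simp: coeff_eq_0)

lemma op_poly_0 [simp]: "op_poly 0 A = 0"
  by (simp add: op_poly_def)

lemma op_poly_pCons: "op_poly (pCons a p) A = a *\<^sub>R id_blinfun + (A o\<^sub>L op_poly p A)"
proof -
  have "op_poly (pCons a p) A = (\<Sum>i\<le>Suc (degree p). coeff (pCons a p) i *\<^sub>R op_pow A i)"
    by (rule op_poly_eq_sum) (rule degree_pCons_le)
  also have "\<dots> = a *\<^sub>R id_blinfun + (\<Sum>i\<le>degree p. coeff p i *\<^sub>R (A o\<^sub>L op_pow A i))"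
    by (subst sum.atMost_Suc_shift) (simp add: op_pow_Suc)
  also have "(\<Sum>i\<le>degree p. coeff p i *\<^sub>R (A o\<^sub>L op_pow A i)) = A o\<^sub>L op_poly p A"
    by (simp add: op_poly_def blinfun_compose.sum_right blinfun_compose.scaleR_right)
  finally show ?thesis .
qed

lemma op_poly_add: "op_poly (p + q) A = op_poly p A + op_poly q A"
proof -
  let ?n = "max (degree p) (degree q)"
  have "op_poly (p + q) A = (\<Sum>i\<le>?n. coeff (p + q) i *\<^sub>R op_pow A i)"
    by (rule op_poly_eq_sum) (rule degree_add_le_max)
  then show ?thesis
    by (simp add: op_poly_eq_sum[of p ?n] op_poly_eq_sum[of q ?n] scaleR_left_distrib sum.distrib)
qed

lemma op_poly_smult: "op_poly (smult c p) A = c *\<^sub>R op_poly p A"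
  by (simp add: op_poly_eq_sum[of _ "degree p"] degree_smult_le scaleR_sum_right)

lemma op_poly_diff: "op_poly (p - q) A = op_poly p A - op_poly q A"
  using op_poly_add[of p "smult (-1) q" A] op_poly_smult[of "-1" q A] by simp

lemma op_poly_mult: "op_poly (p * q) A = op_poly p A o\<^sub>L op_poly q A"
  by (induction p)
    (simp_all add: op_poly_add op_poly_smult op_poly_pCons blinfun_compose.add_left
      blinfun_compose.scaleR_left blinfun_compose_assoc)

lemma op_poly_monom: "op_poly (monom c n) A = c *\<^sub>R op_pow A n"
  by (induction n) (simp_all add: monom_0 monom_Suc op_poly_pCons op_pow_Suc blinfun_compose.scaleR_right)

lemma op_poly_commute:
  assumes "V o\<^sub>L A = A o\<^sub>L V"
  shows "V o\<^sub>L op_poly p A = op_poly p A o\<^sub>L V"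
  by (simp add: op_poly_def blinfun_compose.sum_right blinfun_compose.sum_left
      blinfun_compose.scaleR_right blinfun_compose.scaleR_left op_pow_intertwine[OF assms])

definition symmetric_op :: "('x::real_inner \<Rightarrow>\<^sub>L 'x) \<Rightarrow> bool" where
  "symmetric_op A \<longleftrightarrow> (\<forall>x y. A x \<bullet> y = x \<bullet> A y)"

lemma symmetric_opD: "symmetric_op A \<Longrightarrow> A x \<bullet> y = x \<bullet> A y"
  by (simp add: symmetric_op_def)

lemma symmetric_op_pow: "symmetric_op A \<Longrightarrow> symmetric_op (op_pow A n)"
proof (induction n)
  case 0
  then show ?case by (simp add: symmetric_op_def)
next
  case (Suc n)
  have "op_pow A n (A y) = A (op_pow A n y)" for y
    using op_pow_intertwine[of A A A n] by (metis blinfun_apply_blinfun_compose)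
  then show ?case using Suc by (simp add: op_pow_Suc symmetric_op_def)
qed

lemma symmetric_op_poly: "symmetric_op A \<Longrightarrow> symmetric_op (op_poly p A)"
  using symmetric_op_pow[of A]
  by (simp add: symmetric_op_def op_poly_def blinfun.sum_left blinfun.scaleR_left inner_sum_left
      inner_sum_right)

section \<open>Factoring real polynomials by means of complex roots\<close>

lemma poly_map_of_real_add:
  "poly (map_poly of_real (p + q)) (z::complex) = poly (map_poly of_real p) z + poly (map_poly of_real q) z"
  by (simp flip: poly_add, rule arg_cong[where f = "\<lambda>p. poly p z"]) (simp add: poly_eq_iff coeff_map_poly)

lemma poly_map_of_real_mult:
  "poly (map_poly of_real (p * q)) (z::complex) = poly (map_poly of_real p) z * poly (map_poly of_real q) z"
proof (induction p)
  case (pCons a p)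
  have "poly (map_poly of_real (smult a q)) z = of_real a * poly (map_poly of_real q) z"
    by (simp flip: poly_smult, rule arg_cong[where f = "\<lambda>p. poly p z"]) (simp add: poly_eq_iff coeff_map_poly)
  with pCons show ?case
    by (simp add: map_poly_pCons poly_map_of_real_add algebra_simps)
qed simp

lemma poly_map_of_real_complex_of_real: "poly (map_poly of_real p) (complex_of_real x) = of_real (poly p x)"
  by (induction p) (simp_all add: map_poly_pCons)

lemma real_poly_factor:
  fixes r :: "real poly"
  assumes "degree r \<noteq> 0"
  obtains (linear) a q where "r = [:- a, 1:] * q"
    | (quadratic) a b q where "b \<noteq> 0" "r = [:a\<^sup>2 + b\<^sup>2, - 2 * a, 1:] * q"
proof -
  have "degree (map_poly complex_of_real r) \<noteq> 0" using assms by (simp add: degree_map_poly)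
  then obtain z where z: "poly (map_poly complex_of_real r) z = 0"
    using fundamental_theorem_of_algebra[of "map_poly complex_of_real r"]
      constant_degree[of "map_poly complex_of_real r"] by auto
  show ?thesis
  proof (cases "Im z = 0")
    case True
    then have "z = of_real (Re z)" by (simp add: complex_eq_iff)
    then have "poly r (Re z) = 0"
      using z poly_map_of_real_complex_of_real[of r "Re z"] by simp
    then show ?thesis using linear by (auto simp: poly_eq_0_iff_dvd dvd_def)
  next
    case False
    \<comment> \<open>\<open>g\<close> is the real polynomial with the roots z and its conjugate. A
      real remainder of degree below 2 that vanishes at the nonreal z must be 0.\<close>
    define g where "g = [:(Re z)\<^sup>2 + (Im z)\<^sup>2, - 2 * Re z, 1:]"
    have "poly (map_poly of_real g) z = 0"
      by (simp add: g_def map_poly_pCons complex_eq_iff power2_eq_square algebra_simps)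
    then have rem: "poly (map_poly of_real (r mod g)) z = 0"
      using z poly_map_of_real_add[of "g * (r div g)" "r mod g" z] by (simp add: poly_map_of_real_mult)
    have "degree (r mod g) < 2" 
      using degree_mod_less[of g r] by (auto simp: g_def)
    then have "r mod g = [:coeff (r mod g) 0, coeff (r mod g) 1:]"
      by (intro poly_eqI) (auto simp: coeff_pCons coeff_eq_0 split: nat.split)
    then obtain b0 b1 where b: "r mod g = [:b0, b1:]" by blast
    have "b1 * Im z = 0" "b0 + b1 * Re z = 0"
      using rem by (auto simp: b map_poly_pCons complex_eq_iff mult.commute)
    then have "r mod g = 0" using False b by simp
    then have "r = g * (r div g)" by (metis add_0_right mult_div_mod_eq)
    then show ?thesis using quadratic False unfolding g_def by blast
  qed
qed

text \<open>Operators that are bounded below compose, so the factors can be treated one at a time. A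
  linear factor has its root outside the spectrum and is invertible; a quadratic one is (A - a)^2 +
  b^2, whose form is at least b^2 because \<open>A\<close> is symmetric.\<close>

lemma op_poly_bounded_below:
  assumes sym: "symmetric_op A"
  shows "r \<noteq> 0 \<Longrightarrow> (\<And>l. l \<in> op_spectrum A \<Longrightarrow> poly r l \<noteq> 0) \<Longrightarrow>
    \<exists>c>0. \<forall>x. c * norm x \<le> norm (op_poly r A x)"
proof (induction "degree r" arbitrary: r rule: less_induct)
  case less
  have step: "\<exists>c>0. \<forall>x. c * norm x \<le> norm (op_poly r A x)"
    if r: "r = g * q" and "degree g \<noteq> 0"
      and g: "c1 > 0" "\<And>x. c1 * norm x \<le> norm (op_poly g A x)" for g q c1
  proof -
    have "g \<noteq> 0" "q \<noteq> 0" using less.prems(1) r by auto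
    then have "degree q < degree r" using \<open>degree g \<noteq> 0\<close> r by (simp add: degree_mult_eq)
    moreover have "poly q l \<noteq> 0" if "l \<in> op_spectrum A" for l
      using less.prems(2)[OF that] r by auto
    ultimately obtain c2 where c2: "c2 > 0" "\<And>x. c2 * norm x \<le> norm (op_poly q A x)"
      using less.hyps[of q] \<open>q \<noteq> 0\<close> by blast
    have "(c1 * c2) * norm x \<le> norm (op_poly r A x)" for x
    proof -
      have "(c1 * c2) * norm x \<le> c1 * norm (op_poly q A x)" using c2(2)[of x] g(1) by simp
      also have "\<dots> \<le> norm (op_poly r A x)" using g(2) by (simp add: r op_poly_mult)
      finally show ?thesis .
    qed
    then show ?thesis using g(1) c2(1) by (intro exI[of _ "c1 * c2"]) simp
  qed
  show ?case
  proof (cases "degree r = 0")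
    case True
    then obtain a where a: "r = [:a:]" by (rule degree_eq_zeroE)
    then show ?thesis using less.prems(1)
      by (intro exI[of _ "\<bar>a\<bar>"]) (simp add: op_poly_pCons blinfun.scaleR_left)
  next
    case False
    then show ?thesis
    proof (cases r rule: real_poly_factor)
      case (linear a q)
      then have "a \<notin> op_spectrum A" using less.prems(2)[of a] by auto
      then obtain B where B: "B o\<^sub>L (A - a *\<^sub>R id_blinfun) = id_blinfun"
        unfolding op_spectrum_def by blast
      have eq: "op_poly [:- a, 1:] A = A - a *\<^sub>R id_blinfun" by (simp add: op_poly_pCons)
      have "(1 / (norm B + 1)) * norm x \<le> norm (op_poly [:- a, 1:] A x)" for x
      proof -
        let ?y = "(A - a *\<^sub>R id_blinfun) x"
        have "norm x = norm (B ?y)" by (metis B blinfun_apply_blinfun_compose blinfun_apply_id_blinfun)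
        also have "\<dots> \<le> norm B * norm ?y" by (rule norm_blinfun)
        also have "\<dots> \<le> (norm B + 1) * norm ?y" by (intro mult_right_mono) auto
        finally show ?thesis
          using norm_ge_zero[of B] by (simp add: eq field_simps add_pos_nonneg)
      qed
      then show ?thesis
        by (intro step[OF linear, of "1 / (norm B + 1)"]) (simp_all add: add_nonneg_pos)
    next
      case (quadratic a b q)
      let ?g = "[:a\<^sup>2 + b\<^sup>2, - 2 * a, 1:]"
      have "b\<^sup>2 * norm x \<le> norm (op_poly ?g A x)" for x
      proof -
        have eq: "op_poly ?g A x = (a\<^sup>2 + b\<^sup>2) *\<^sub>R x - (2 * a) *\<^sub>R A x + A (A x)"
          by (simp add: op_poly_pCons blinfun.bilinear_simps)
        have "x \<bullet> op_poly ?g A x = (norm (A x - a *\<^sub>R x))\<^sup>2 + b\<^sup>2 * (norm x)\<^sup>2"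
          unfolding eq power2_norm_eq_inner
          by (simp add: inner_diff_left inner_diff_right inner_add_right symmetric_opD[OF sym]
              algebra_simps power2_eq_square)
        then have "b\<^sup>2 * norm x * norm x \<le> x \<bullet> op_poly ?g A x"
          by (simp add: power2_eq_square)
        also have "\<dots> \<le> norm (op_poly ?g A x) * norm x"
          by (metis norm_cauchy_schwarz mult.commute)
        finally show ?thesis by (cases "x = 0") (simp_all add: mult_le_cancel_right)
      qed
      then show ?thesis using quadratic(1)
        by (intro step[OF quadratic(2), of "b\<^sup>2"]) simp_all
    qed
  qed
qed

text \<open>With s = \<open>norm S\<close>, the squared norm of s^2 x - S^2 x is at most s^2 (s^2
  |x|^2 - |S x|^2). A lower bound \<open>c\<close> would therefore improve the operator norm of
  \<open>S\<close> to below s. Concluding \<open>x = 0\<close> for every x states the contradiction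
  in a way that admits the zero space.\<close>

lemma symmetric_norm_sq_approximate_eigenvalue:
  fixes S :: "'x::real_inner \<Rightarrow>\<^sub>L 'x" and x :: 'x
  assumes sym: "symmetric_op S" and c: "c > 0"
    and below: "\<And>x. c * norm x \<le> norm ((norm S)\<^sup>2 *\<^sub>R x - S (S x))"
  shows "x = 0"
proof (cases "S = 0")
  case True
  then show ?thesis using below[of x] c by (simp add: mult_le_0_iff)
next
  case False
  define s where "s = norm S"
  have s: "s > 0" using False by (simp add: s_def)
  have key: "(norm (S x))\<^sup>2 \<le> (s\<^sup>2 - c\<^sup>2 / s\<^sup>2) * (norm x)\<^sup>2" for x
  proof -
    have "(norm (S (S x)))\<^sup>2 \<le> s\<^sup>2 * (norm (S x))\<^sup>2"
      using norm_blinfun[of S "S x"] by (simp add: s_def flip: power_mult_distrib)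
    moreover have "(norm (s\<^sup>2 *\<^sub>R x - S (S x)))\<^sup>2
        = s\<^sup>2 * s\<^sup>2 * (norm x)\<^sup>2 - 2 * s\<^sup>2 * (norm (S x))\<^sup>2 + (norm (S (S x)))\<^sup>2"
      unfolding power2_norm_eq_inner
      by (simp add: inner_diff_left inner_diff_right symmetric_opD[OF sym] inner_commute[of "S (S x)" x] algebra_simps)
    moreover have "c\<^sup>2 * (norm x)\<^sup>2 \<le> (norm (s\<^sup>2 *\<^sub>R x - S (S x)))\<^sup>2"
      using below[of x] c unfolding power_mult_distrib[symmetric] s_def by (intro power_mono) auto
    ultimately have "c\<^sup>2 * (norm x)\<^sup>2 \<le> s\<^sup>2 * s\<^sup>2 * (norm x)\<^sup>2 - s\<^sup>2 * (norm (S x))\<^sup>2" by linarith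
    then show ?thesis using s by (simp add: field_simps)
  qed
  define k where "k = max 0 (s\<^sup>2 - c\<^sup>2 / s\<^sup>2)"
  have "norm S \<le> sqrt k"
  proof (rule norm_blinfun_bound)
    fix x
    have "(norm (S x))\<^sup>2 \<le> k * (norm x)\<^sup>2"
      by (rule order_trans[OF key]) (auto simp: k_def intro!: mult_right_mono)
    then have "sqrt ((norm (S x))\<^sup>2) \<le> sqrt (k * (norm x)\<^sup>2)" by (rule real_sqrt_le_mono)
    then show "norm (S x) \<le> sqrt k * norm x" by (simp add: real_sqrt_mult)
  qed (simp add: k_def)
  then have "s\<^sup>2 \<le> (sqrt k)\<^sup>2" using s unfolding s_def by (intro power_mono) auto
  also have "\<dots> = k" by (simp add: k_def)
  also have "k < s\<^sup>2" using s c by (simp add: k_def)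
  finally show ?thesis by simp
qed

text \<open>On an empty spectrum every nonzero polynomial of \<open>A\<close> would be bounded
  below, in particular |A|^2 - X^2. Nonemptiness ensures below that a polynomial positive on the
  spectrum is nonzero.\<close>

lemma op_spectrum_nonempty:
  assumes "symmetric_op (A :: 'x::real_inner \<Rightarrow>\<^sub>L 'x)" "(x::'x) \<noteq> 0"
  shows "op_spectrum A \<noteq> {}"
proof
  assume "op_spectrum A = {}"
  then obtain c where c: "c > 0" "\<And>x. c * norm x \<le> norm (op_poly [:(norm A)\<^sup>2, 0, -1:] A x)"
    using op_poly_bounded_below[OF assms(1), of "[:(norm A)\<^sup>2, 0, -1:]"] by auto
  have "op_poly [:(norm A)\<^sup>2, 0, -1:] A x = (norm A)\<^sup>2 *\<^sub>R x - A (A x)" for x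
    by (simp add: op_poly_pCons blinfun.bilinear_simps)
  then have "x = 0"
    using c by (intro symmetric_norm_sq_approximate_eigenvalue[OF assms(1) c(1)]) simp
  with assms(2) show False by simp
qed

text \<open>If the norm s exceeded \<open>m\<close>, then s^2 - p^2 would be positive on the
  spectrum and s^2 - p(A)^2 bounded below, against the approximate eigenvalue property of the
  symmetric operator p(A).\<close>

lemma norm_op_poly_le:
  fixes A :: "'x::real_inner \<Rightarrow>\<^sub>L 'x"
  assumes sym: "symmetric_op A" and m: "0 \<le> m"
    and le: "\<And>l. l \<in> op_spectrum A \<Longrightarrow> \<bar>poly p l\<bar> \<le> m"
  shows "norm (op_poly p A) \<le> m"
proof (rule ccontr)
  define s where "s = norm (op_poly p A)"
  define r where "r = [:s\<^sup>2:] - p * p"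
  assume "\<not> norm (op_poly p A) \<le> m"
  then have s: "m < s" by (simp add: s_def)
  then have "op_poly p A \<noteq> 0" using m s_def by auto
  then obtain x0 where "op_poly p A x0 \<noteq> 0" by (metis blinfun_eqI zero_blinfun.rep_eq)
  then have "x0 \<noteq> 0" by (metis blinfun.zero_right)
  have pos: "poly r l > 0" if "l \<in> op_spectrum A" for l
  proof -
    have "\<bar>poly p l\<bar>\<^sup>2 < s\<^sup>2" using le[OF that] s m by (intro power_strict_mono) auto
    then show ?thesis by (simp add: r_def power2_eq_square)
  qed
  have "r \<noteq> 0" using pos op_spectrum_nonempty[OF sym \<open>x0 \<noteq> 0\<close>] by fastforce
  then obtain c where c: "c > 0" "\<And>x. c * norm x \<le> norm (op_poly r A x)"
    using op_poly_bounded_below[OF sym, of r] pos by (metis less_irrefl)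
  have "op_poly r A x = (norm (op_poly p A))\<^sup>2 *\<^sub>R x - op_poly p A (op_poly p A x)" for x
    by (simp add: r_def s_def op_poly_diff op_poly_mult op_poly_pCons blinfun.bilinear_simps)
  then have "x0 = 0"
    using c by (intro symmetric_norm_sq_approximate_eigenvalue[OF symmetric_op_poly[OF sym, of p] c(1)]) simp
  with \<open>x0 \<noteq> 0\<close> show False by simp
qed

subsection \<open>Functional calculus of positive operators\<close>

definition positive_op :: "('x::real_inner \<Rightarrow>\<^sub>L 'x) \<Rightarrow> bool" where
  "positive_op A \<longleftrightarrow> symmetric_op A \<and> (\<forall>x. 0 \<le> x \<bullet> A x)"

lemma positive_op_symmetric: "positive_op A \<Longrightarrow> symmetric_op A"
  by (simp add: positive_op_def)

lemma inner_le_norm_op: "x \<bullet> A x \<le> norm A * (norm x)\<^sup>2" for A :: "'x::real_inner \<Rightarrow>\<^sub>L 'x"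
proof -
  have "x \<bullet> A x \<le> norm x * (norm A * norm x)"
    by (rule order_trans[OF norm_cauchy_schwarz]) (simp add: mult_left_mono norm_blinfun)
  then show ?thesis by (simp add: power2_eq_square mult_ac)
qed

text \<open>For l outside this interval, A - l or its negative is coercive.\<close>

lemma op_spectrum_positive_subset:
  fixes A :: "'x::{real_inner,complete_space} \<Rightarrow>\<^sub>L 'x"
  assumes "positive_op A"
  shows "op_spectrum A \<subseteq> {0..norm A}"
proof
  fix l assume l: "l \<in> op_spectrum A"
  have "0 \<le> l"
  proof (rule ccontr)
    assume "\<not> 0 \<le> l"
    then have "0 < - l" by simp
    moreover have "- l * (norm x)\<^sup>2 \<le> x \<bullet> (A - l *\<^sub>R id_blinfun) x" for x
      using assms by (simp add: positive_op_def blinfun.diff_left blinfun.scaleR_left inner_diff_right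
          power2_norm_eq_inner)
    ultimately obtain D where "(A - l *\<^sub>R id_blinfun) o\<^sub>L D = id_blinfun"
      "D o\<^sub>L (A - l *\<^sub>R id_blinfun) = id_blinfun"
      using coercive_invertible[of "- l" "A - l *\<^sub>R id_blinfun"] by blast
    then show False using l unfolding op_spectrum_def by blast
  qed
  moreover have "l \<le> norm A"
  proof (rule ccontr)
    assume "\<not> l \<le> norm A"
    then have "0 < l - norm A" by simp
    moreover have "(l - norm A) * (norm x)\<^sup>2 \<le> x \<bullet> (- (A - l *\<^sub>R id_blinfun)) x" for x
      using inner_le_norm_op[of x A]
      by (simp add: blinfun.bilinear_simps inner_diff_right power2_norm_eq_inner algebra_simps)
    ultimately obtain D where "- (A - l *\<^sub>R id_blinfun) o\<^sub>L D = id_blinfun"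
      "D o\<^sub>L - (A - l *\<^sub>R id_blinfun) = id_blinfun"
      using coercive_invertible[of "l - norm A" "- (A - l *\<^sub>R id_blinfun)"] by blast
    then have "(A - l *\<^sub>R id_blinfun) o\<^sub>L (- D) = id_blinfun" "(- D) o\<^sub>L (A - l *\<^sub>R id_blinfun) = id_blinfun"
      by (simp_all only: blinfun_compose.minus_left blinfun_compose.minus_right)
    then show False using l unfolding op_spectrum_def by blast
  qed
  ultimately show "l \<in> {0..norm A}" by simp
qed

text \<open>If 0 \<le> r \<le> R on the interval, then |R - r| \<le> R there, so R - r(A) has norm
  at most R and its form at x is at most R |x|^2.\<close>

lemma op_poly_nonneg:
  fixes A :: "'x::{real_inner,complete_space} \<Rightarrow>\<^sub>L 'x"
  assumes A: "positive_op A" and nonneg: "\<And>l. l \<in> {0..norm A} \<Longrightarrow> 0 \<le> poly r l"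
  shows "0 \<le> x \<bullet> op_poly r A x"
proof -
  have "compact (poly r ` {0..norm A})"
    by (intro compact_continuous_image continuous_intros) auto
  then have "bounded (poly r ` {0..norm A})" by (rule compact_imp_bounded)
  then obtain R where R: "R > 0" "\<And>l. l \<in> {0..norm A} \<Longrightarrow> \<bar>poly r l\<bar> \<le> R"
    unfolding bounded_pos by auto
  have "norm (op_poly ([:R:] - r) A) \<le> R"
  proof (rule norm_op_poly_le)
    fix l assume "l \<in> op_spectrum A"
    then have "l \<in> {0..norm A}" using op_spectrum_positive_subset[OF A] by blast
    then show "\<bar>poly ([:R:] - r) l\<bar> \<le> R" using nonneg[of l] R(2)[of l] by simp
  qed (use A R in \<open>auto simp: positive_op_def\<close>)
  then have "x \<bullet> op_poly ([:R:] - r) A x \<le> R * (norm x)\<^sup>2"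
    by (intro order_trans[OF inner_le_norm_op] mult_right_mono) auto
  then show ?thesis
    by (simp add: op_poly_diff op_poly_pCons blinfun.bilinear_simps inner_diff_right power2_norm_eq_inner)
qed

text \<open>Squares are compared: q^2 - p^2 is nonnegative on the interval, and symmetry turns the
  forms of p(A)^2 and q(A)^2 into squared norms.\<close>

lemma norm_op_poly_apply_mono:
  fixes A :: "'x::{real_inner,complete_space} \<Rightarrow>\<^sub>L 'x"
  assumes A: "positive_op A" and le: "\<And>l. l \<in> {0..norm A} \<Longrightarrow> \<bar>poly p l\<bar> \<le> poly q l"
  shows "norm (op_poly p A x) \<le> norm (op_poly q A x)"
proof -
  have "0 \<le> x \<bullet> op_poly (q * q - p * p) A x"
  proof (rule op_poly_nonneg[OF A])
    fix l assume "l \<in> {0..norm A}"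
    from le[OF this] have "\<bar>poly p l\<bar> * \<bar>poly p l\<bar> \<le> poly q l * poly q l"
      by (intro mult_mono) auto
    then show "0 \<le> poly (q * q - p * p) l" by simp
  qed
  moreover have "x \<bullet> op_poly (p * p) A x = (norm (op_poly p A x))\<^sup>2" for p
    using symmetric_op_poly[OF positive_op_symmetric[OF A], of p]
    by (simp add: op_poly_mult power2_norm_eq_inner symmetric_opD)
  ultimately have "(norm (op_poly p A x))\<^sup>2 \<le> (norm (op_poly q A x))\<^sup>2"
    by (simp add: op_poly_diff blinfun.diff_left inner_diff_right)
  then show ?thesis by (rule power2_le_imp_le) simp
qed

section \<open>Continuous functions of a positive operator as limits of polynomials\<close>

lemma poly_approximation:
  fixes f :: "real \<Rightarrow> real"
  assumes "compact K" "continuous_on K f"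
  obtains p where "uniform_limit K (\<lambda>n. poly (p n)) f sequentially"
proof -
  have "\<exists>p. \<forall>x\<in>K. \<bar>f x - poly p x\<bar> < inverse (real (Suc n))" for n
  proof -
    obtain g where g: "real_polynomial_function g" "\<And>x. x \<in> K \<Longrightarrow> \<bar>f x - g x\<bar> < inverse (real (Suc n))"
      using Stone_Weierstrass_real_polynomial_function[OF assms, of "inverse (real (Suc n))"]
      by (metis inverse_positive_iff_positive of_nat_0_less_iff zero_less_Suc)
    obtain a N where "g = (\<lambda>x. \<Sum>i\<le>N. a i * x ^ i)"
      using g(1) real_polynomial_function_iff_sum by blast
    then have "poly (\<Sum>i\<le>N. monom (a i) i) x = g x" for x
      by (simp add: poly_sum poly_monom)
    then show ?thesis using g(2) by (intro exI[of _ "\<Sum>i\<le>N. monom (a i) i"]) simp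
  qed
  then obtain p where p: "\<And>n x. x \<in> K \<Longrightarrow> \<bar>f x - poly (p n) x\<bar> < inverse (real (Suc n))" by metis
  have "uniform_limit K (\<lambda>n. poly (p n)) f sequentially"
  proof (rule uniform_limitI)
    fix e :: real assume "0 < e"
    then obtain N where N: "inverse (real (Suc N)) < e" using reals_Archimedean by blast
    show "\<forall>\<^sub>F n in sequentially. \<forall>x\<in>K. dist (poly (p n) x) (f x) < e"
    proof (rule eventually_sequentiallyI, intro ballI)
      fix n x assume "N \<le> n" "x \<in> K"
      then have "inverse (real (Suc n)) \<le> inverse (real (Suc N))" by (simp add: le_imp_inverse_le)
      then have "\<bar>f x - poly (p n) x\<bar> < e"
        using p[OF \<open>x \<in> K\<close>, of n] N by linarith
      then show "dist (poly (p n) x) (f x) < e" by (simp add: dist_real_def abs_minus_commute)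
    qed
  qed
  then show ?thesis by (rule that)
qed

lemma norm_op_poly_diff_le:
  fixes A :: "'x::real_inner \<Rightarrow>\<^sub>L 'x"
  assumes sym: "symmetric_op A" and "0 \<le> e"
    and "\<And>l. l \<in> op_spectrum A \<Longrightarrow> dist (poly p l) (f l) \<le> e / 2"
    and "\<And>l. l \<in> op_spectrum A \<Longrightarrow> dist (poly q l) (f l) \<le> e / 2"
  shows "norm (op_poly p A - op_poly q A) \<le> e"
  unfolding op_poly_diff[symmetric]
proof (rule norm_op_poly_le[OF sym \<open>0 \<le> e\<close>])
  fix l assume "l \<in> op_spectrum A"
  from assms(3,4)[OF this] show "\<bar>poly (p - q) l\<bar> \<le> e"
    unfolding dist_real_def poly_diff by linarith
qed

text \<open>Resolves the \<open>THE\<close> in \<open>op_fun\<close>: the spectral norm bound makes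
  approximating polynomials Cauchy and any two approximating sequences equivalent. The sequence
  obtained converges uniformly on all of \<open>{0..norm A}\<close>, where later estimates are
  made.\<close>

lemma op_fun_approximation:
  fixes A :: "'x::{real_inner,complete_space} \<Rightarrow>\<^sub>L 'x"
  assumes A: "positive_op A" and f: "continuous_on {0..norm A} f"
  obtains p where "uniform_limit {0..norm A} (\<lambda>n. poly (p n)) f sequentially"
    "(\<lambda>n. op_poly (p n) A) \<longlonglongrightarrow> op_fun f A"
proof -
  note sym = positive_op_symmetric[OF A]
  note sub = op_spectrum_positive_subset[OF A]
  obtain p where p: "uniform_limit {0..norm A} (\<lambda>n. poly (p n)) f sequentially"
    using poly_approximation[OF _ f] by auto
  have p': "uniform_limit (op_spectrum A) (\<lambda>n. poly (p n)) f sequentially"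
    by (rule uniform_limit_on_subset[OF p sub])
  have "Cauchy (\<lambda>n. op_poly (p n) A)"
  proof (rule CauchyI)
    fix e :: real assume "0 < e"
    then obtain N where N: "\<And>n l. n \<ge> N \<Longrightarrow> l \<in> op_spectrum A \<Longrightarrow> dist (poly (p n) l) (f l) < (e / 2) / 2"
      using uniform_limitD[OF p', of "(e / 2) / 2"] by (auto simp: eventually_sequentially)
    have "norm (op_poly (p m) A - op_poly (p n) A) \<le> e / 2" if "m \<ge> N" "n \<ge> N" for m n
    proof (rule norm_op_poly_diff_le[OF sym, where f = f])
      fix l assume "l \<in> op_spectrum A"
      then show "dist (poly (p m) l) (f l) \<le> e / 2 / 2" "dist (poly (p n) l) (f l) \<le> e / 2 / 2"
        using N[OF that(1)] N[OF that(2)] by (auto intro: less_imp_le)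
    qed (use \<open>0 < e\<close> in simp)
    then have "norm (op_poly (p m) A - op_poly (p n) A) < e" if "m \<ge> N" "n \<ge> N" for m n
      using that \<open>0 < e\<close> by fastforce
    then show "\<exists>M. \<forall>m\<ge>M. \<forall>n\<ge>M. norm (op_poly (p m) A - op_poly (p n) A) < e"
      by blast
  qed
  then obtain B where B: "(\<lambda>n. op_poly (p n) A) \<longlonglongrightarrow> B"
    using Cauchy_convergent_blinfun convergent_def by blast
  have "op_fun f A = B"
    unfolding op_fun_def
  proof (rule the_equality)
    show "\<exists>p. uniform_limit (op_spectrum A) (\<lambda>n. poly (p n)) f sequentially \<and> (\<lambda>n. op_poly (p n) A) \<longlonglongrightarrow> B"
      using p' B by blast
  next
    fix B' assume "\<exists>p. uniform_limit (op_spectrum A) (\<lambda>n. poly (p n)) f sequentially \<and>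
      (\<lambda>n. op_poly (p n) A) \<longlonglongrightarrow> B'"
    then obtain q where q: "uniform_limit (op_spectrum A) (\<lambda>n. poly (q n)) f sequentially"
      and B': "(\<lambda>n. op_poly (q n) A) \<longlonglongrightarrow> B'" by blast
    have "norm (B' - B) \<le> e" if "0 < e" for e
    proof (rule tendsto_upperbound[OF tendsto_norm[OF tendsto_diff[OF B' B]]])
      have "\<forall>\<^sub>F n in sequentially. \<forall>l\<in>op_spectrum A. dist (poly (q n) l) (f l) < e / 2"
        "\<forall>\<^sub>F n in sequentially. \<forall>l\<in>op_spectrum A. dist (poly (p n) l) (f l) < e / 2"
        using uniform_limitD[OF q, of "e / 2"] uniform_limitD[OF p', of "e / 2"] that by auto
      then show "\<forall>\<^sub>F n in sequentially. norm (op_poly (q n) A - op_poly (p n) A) \<le> e"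
      proof eventually_elim
        case (elim n)
        then show ?case
          using that by (intro norm_op_poly_diff_le[OF sym, where f = f]) (auto intro: less_imp_le)
      qed
    qed simp
    then have "norm (B' - B) \<le> 0" by (rule field_le_epsilon) simp
    then show "B' = B" by simp
  qed
  then show ?thesis using that p B by blast
qed

text \<open>Polynomials within d of \<open>f\<close> are dominated by q + d, so the polynomial
  comparison applies before the limit; the shift costs only d |x| \<le> e.\<close>

lemma norm_op_fun_apply_le:
  fixes A :: "'x::{real_inner,complete_space} \<Rightarrow>\<^sub>L 'x"
  assumes A: "positive_op A" and f: "continuous_on {0..norm A} f"
    and le: "\<And>l. l \<in> {0..norm A} \<Longrightarrow> \<bar>f l\<bar> \<le> poly q l"
  shows "norm (op_fun f A x) \<le> norm (op_poly q A x)"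
proof (rule field_le_epsilon)
  fix e :: real assume "0 < e"
  define d where "d = e / (norm x + 1)"
  have "0 < norm x + 1" by (simp add: add_nonneg_pos)
  then have d: "0 < d" "d * norm x \<le> e"
    using \<open>0 < e\<close> unfolding d_def by (simp_all add: pos_divide_le_eq algebra_simps)
  obtain p where p: "uniform_limit {0..norm A} (\<lambda>n. poly (p n)) f sequentially"
    and lim: "(\<lambda>n. op_poly (p n) A) \<longlonglongrightarrow> op_fun f A"
    using op_fun_approximation[OF A f] by blast
  show "norm (op_fun f A x) \<le> norm (op_poly q A x) + e"
  proof (rule tendsto_upperbound)
    show "(\<lambda>n. norm (op_poly (p n) A x)) \<longlonglongrightarrow> norm (op_fun f A x)"
      by (intro tendsto_intros lim)
    show "\<forall>\<^sub>F n in sequentially. norm (op_poly (p n) A x) \<le> norm (op_poly q A x) + e"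
      using uniform_limitD[OF p d(1)]
    proof eventually_elim
      case (elim n)
      have "norm (op_poly (p n) A x) \<le> norm (op_poly (q + [:d:]) A x)"
      proof (rule norm_op_poly_apply_mono[OF A])
        fix l assume l: "l \<in> {0..norm A}"
        then have "\<bar>poly (p n) l - f l\<bar> < d" using elim by (simp add: dist_real_def)
        then show "\<bar>poly (p n) l\<bar> \<le> poly (q + [:d:]) l" using le[OF l] by simp
      qed
      also have "\<dots> = norm (op_poly q A x + d *\<^sub>R x)"
        by (simp add: op_poly_add op_poly_pCons blinfun.bilinear_simps)
      also have "\<dots> \<le> norm (op_poly q A x) + e"
        using d by (intro order_trans[OF norm_triangle_ineq]) simp
      finally show ?case .
    qed
  qed simp
qed

lemma op_fun_commute:
  fixes A :: "'x::{real_inner,complete_space} \<Rightarrow>\<^sub>L 'x"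
  assumes A: "positive_op A" and f: "continuous_on {0..norm A} f" and V: "V o\<^sub>L A = A o\<^sub>L V"
  shows "V o\<^sub>L op_fun f A = op_fun f A o\<^sub>L V"
proof -
  obtain p where lim: "(\<lambda>n. op_poly (p n) A) \<longlonglongrightarrow> op_fun f A"
    using op_fun_approximation[OF A f] by blast
  have "(\<lambda>n. V o\<^sub>L op_poly (p n) A) \<longlonglongrightarrow> (V o\<^sub>L op_fun f A)"
    by (intro tendsto_intros lim)
  moreover have "(\<lambda>n. V o\<^sub>L op_poly (p n) A) \<longlonglongrightarrow> (op_fun f A o\<^sub>L V)"
    unfolding op_poly_commute[OF V] by (intro tendsto_intros lim)
  ultimately show ?thesis by (rule LIMSEQ_unique)
qed

section \<open>Exponential generating functions of operator sequences\<close>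

text \<open>With the weights s^n / n!, dropping the first coefficient differentiates and prepending
  0 integrates from 0, so the calculus of hyperbolic functions becomes index shifting.\<close>

definition egf :: "(nat \<Rightarrow> 'a::real_normed_vector) \<Rightarrow> real \<Rightarrow> 'a" where
  "egf v s = (\<Sum>n. (s ^ n / fact n) *\<^sub>R v n)"

text \<open>Growth at most geometric makes the series converge at every real argument.\<close>

definition geom_bounded :: "(nat \<Rightarrow> 'a::real_normed_vector) \<Rightarrow> bool" where
  "geom_bounded v \<longleftrightarrow> (\<exists>K M. \<forall>n. norm (v n) \<le> K * M ^ n)"

lemma geom_boundedE:
  assumes "geom_bounded v"
  obtains K M where "0 \<le> K" "0 \<le> M" "\<And>n. norm (v n) \<le> K * M ^ n"
proof -
  obtain K M where KM: "\<And>n. norm (v n) \<le> K * M ^ n"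
    using assms geom_bounded_def by blast
  have "norm (v n) \<le> \<bar>K\<bar> * \<bar>M\<bar> ^ n" for n
    using KM[of n] abs_ge_self[of "K * M ^ n"] by (simp add: abs_mult power_abs)
  then show ?thesis by (intro that[of "\<bar>K\<bar>" "\<bar>M\<bar>"]) auto
qed

lemma geom_bounded_Suc:
  assumes "geom_bounded v" shows "geom_bounded (\<lambda>n. v (Suc n))"
proof -
  obtain K M where "\<And>n. norm (v n) \<le> K * M ^ n" using geom_boundedE[OF assms] by blast
  then have "norm (v (Suc n)) \<le> (K * M) * M ^ n" for n by (simp add: mult.assoc flip: power_Suc)
  then show ?thesis unfolding geom_bounded_def by blast
qed

lemma egf_sums:
  fixes v :: "nat \<Rightarrow> 'a::real_normed_vector \<Rightarrow>\<^sub>L 'b::{real_normed_vector,complete_space}"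
  assumes "geom_bounded v"
  shows "(\<lambda>n. (s ^ n / fact n) *\<^sub>R v n) sums egf v s"
proof -
  obtain K M where KM: "0 \<le> K" "0 \<le> M" "\<And>n. norm (v n) \<le> K * M ^ n"
    using geom_boundedE[OF assms] by blast
  have "summable (\<lambda>n. (s ^ n / fact n) *\<^sub>R v n)"
  proof (rule summable_blinfun_comparison)
    show "summable (\<lambda>n. K * (inverse (fact n) * (\<bar>s\<bar> * M) ^ n))"
      by (intro summable_mult summable_exp)
    show "norm ((s ^ n / fact n) *\<^sub>R v n) \<le> K * (inverse (fact n) * (\<bar>s\<bar> * M) ^ n)" for n
      using mult_left_mono[OF KM(3)[of n], of "\<bar>s\<bar> ^ n / fact n"]
      by (simp add: power_mult_distrib power_abs field_simps)
  qed
  then show ?thesis unfolding egf_def by (rule summable_sums)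
qed

lemma egf_0:
  fixes v :: "nat \<Rightarrow> 'a::real_normed_vector \<Rightarrow>\<^sub>L 'b::{real_normed_vector,complete_space}"
  assumes "geom_bounded v"
  shows "egf v 0 = v 0"
proof (rule sums_unique2[OF egf_sums[OF assms]])
  have "(\<lambda>n. (0 ^ n / fact n) *\<^sub>R v n) = (\<lambda>n. if n = 0 then v 0 else 0)"
    by (auto simp: power_0_left)
  then show "(\<lambda>n. (0 ^ n / fact n) *\<^sub>R v n) sums v 0" using sums_single[of 0 "\<lambda>_. v 0"] by simp
qed

lemma norm_sums_le_of_norm_le:
  fixes f :: "nat \<Rightarrow> 'a::real_normed_vector"
  assumes "f sums l" "g sums b" "\<And>n. norm (f n) \<le> g n"
  shows "norm l \<le> b"
proof (rule LIMSEQ_le)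
  show "(\<lambda>n. norm (\<Sum>i<n. f i)) \<longlonglongrightarrow> norm l" using assms(1) by (auto simp: sums_def intro: tendsto_norm)
  show "(\<lambda>n. \<Sum>i<n. g i) \<longlonglongrightarrow> b" using assms(2) by (simp add: sums_def)
  show "\<exists>N. \<forall>n\<ge>N. norm (\<Sum>i<n. f i) \<le> (\<Sum>i<n. g i)" using assms(3) by (auto intro: sum_norm_le)
qed

lemma egf_has_vector_derivative:
  fixes v :: "nat \<Rightarrow> 'a::real_normed_vector \<Rightarrow>\<^sub>L 'b::{real_normed_vector,complete_space}"
  assumes v: "geom_bounded v"
  shows "(egf v has_vector_derivative egf (\<lambda>n. v (Suc n)) s) (at s)"
proof -
  obtain K M where KM: "0 \<le> K" "0 \<le> M" "\<And>n. norm (v n) \<le> K * M ^ n"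
    using geom_boundedE[OF v] by blast
  \<comment> \<open>\<open>R\<close> bounds both |s| and |s + h| for |h| < 1; \<open>b n\<close>
    then majorizes the n-th term of the second derivative, which controls the remainder of the
    difference quotient.\<close>
  define R where "R = \<bar>s\<bar> + 1"
  define b where "b n = real n * real (n - Suc 0) * R ^ (n - 2) / fact n * (K * M ^ n)" for n
  have "summable (\<lambda>n. b (n + 2))"
  proof -
    have "b (n + 2) = K * M\<^sup>2 * (inverse (fact n) * (R * M) ^ n)" for n
    proof -
      define c where "c = real (n + 2) * real (n + 1)"
      have "c \<noteq> 0" by (simp only: c_def mult_eq_0_iff of_nat_eq_0_iff) simp
      moreover have "fact (n + 2) = c * fact n" by (simp add: c_def algebra_simps)
      moreover have "b (n + 2) = c * R ^ n / fact (n + 2) * (K * (M ^ n * M\<^sup>2))"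
        by (simp only: b_def c_def power_add) simp
      ultimately show ?thesis by (simp add: power_mult_distrib field_simps)
    qed
    then show ?thesis by (auto intro!: summable_mult summable_exp)
  qed
  then have "summable b" by (rule summable_iff_shift[THEN iffD1])
  then have b: "b sums suminf b" by (rule summable_sums)
  have deriv: "(\<lambda>n. (real n * s ^ (n - Suc 0) / fact n) *\<^sub>R v n) sums egf (\<lambda>n. v (Suc n)) s"
  proof -
    have "(real (Suc n) * s ^ n / fact (Suc n)) *\<^sub>R v (Suc n) = (s ^ n / fact n) *\<^sub>R v (Suc n)" for n
      by simp
    then have "(\<lambda>n. (real (Suc n) * s ^ (Suc n - Suc 0) / fact (Suc n)) *\<^sub>R v (Suc n))
      sums egf (\<lambda>n. v (Suc n)) s"
      using egf_sums[OF geom_bounded_Suc[OF v], of s] by simp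
    from sums_Suc[OF this] show ?thesis by simp
  qed
  have quot: "norm (egf v (s + h) - egf v s - h *\<^sub>R egf (\<lambda>n. v (Suc n)) s) / norm h \<le> \<bar>h\<bar> * suminf b"
    if h: "h \<noteq> 0" "\<bar>h\<bar> < 1" for h
  proof -
    let ?d = "\<lambda>n. ((s + h) ^ n - s ^ n) / h - real n * s ^ (n - Suc 0)"
    have "(\<lambda>n. (h * ?d n / fact n) *\<^sub>R v n) sums (egf v (s + h) - egf v s - h *\<^sub>R egf (\<lambda>n. v (Suc n)) s)"
    proof -
      have "(h * ?d n / fact n) *\<^sub>R v n = ((s + h) ^ n / fact n) *\<^sub>R v n - (s ^ n / fact n) *\<^sub>R v n
          - h *\<^sub>R ((real n * s ^ (n - Suc 0) / fact n) *\<^sub>R v n)" for n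
        using h(1) by (simp add: field_simps flip: scaleR_left_diff_distrib)
      then show ?thesis
        by (simp only:) (intro sums_diff egf_sums[OF v] bounded_linear.sums[OF bounded_linear_scaleR_right] deriv)
    qed
    moreover have "(\<lambda>n. \<bar>h\<bar> * \<bar>h\<bar> * b n) sums (\<bar>h\<bar> * \<bar>h\<bar> * suminf b)"
      by (rule sums_mult[OF b])
    moreover have "norm ((h * ?d n / fact n) *\<^sub>R v n) \<le> \<bar>h\<bar> * \<bar>h\<bar> * b n" for n
    proof -
      have "\<bar>?d n\<bar> \<le> real n * real (n - Suc 0) * R ^ (n - 2) * \<bar>h\<bar>"
        using lemma_termdiff3[of h s R n] h by (simp add: R_def)
      then have "\<bar>h\<bar> * \<bar>?d n\<bar> / fact n * norm (v n)
          \<le> \<bar>h\<bar> * (real n * real (n - Suc 0) * R ^ (n - 2) * \<bar>h\<bar>) / fact n * (K * M ^ n)"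
        by (intro mult_mono divide_right_mono mult_left_mono KM(3)) (auto simp: R_def KM)
      then show ?thesis by (simp add: b_def abs_mult mult_ac del: abs_mult_self_eq)
    qed
    ultimately have "norm (egf v (s + h) - egf v s - h *\<^sub>R egf (\<lambda>n. v (Suc n)) s) \<le> \<bar>h\<bar> * \<bar>h\<bar> * suminf b"
      by (rule norm_sums_le_of_norm_le)
    then show ?thesis using h by (simp add: pos_divide_le_eq mult_ac)
  qed
  show ?thesis
    unfolding has_vector_derivative_def has_derivative_at
  proof (intro conjI bounded_linear_scaleR_left)
    show "(\<lambda>h. norm (egf v (s + h) - egf v s - h *\<^sub>R egf (\<lambda>n. v (Suc n)) s) / norm h) \<midarrow>0\<rightarrow> 0"
    proof (rule tendsto_sandwich[OF _ _ tendsto_const])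
      show "\<forall>\<^sub>F h in at 0. norm (egf v (s + h) - egf v s - h *\<^sub>R egf (\<lambda>n. v (Suc n)) s) / norm h
          \<le> \<bar>h\<bar> * suminf b"
        unfolding eventually_at using quot by (intro exI[of _ 1]) (auto simp: dist_real_def)
      show "((\<lambda>h. \<bar>h\<bar> * suminf b) \<longlongrightarrow> 0) (at 0)"
        by (auto intro!: tendsto_eq_intros)
    qed (auto intro!: always_eventually)
  qed
qed

lemma egf_intertwine:
  fixes v :: "nat \<Rightarrow> 'a::{real_normed_vector,complete_space} \<Rightarrow>\<^sub>L 'a"
    and w :: "nat \<Rightarrow> 'b::{real_normed_vector,complete_space} \<Rightarrow>\<^sub>L 'b"
  assumes "geom_bounded v" "geom_bounded w" "\<And>n. V o\<^sub>L v n = w n o\<^sub>L V"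
  shows "V o\<^sub>L egf v s = egf w s o\<^sub>L V"
proof (rule sums_unique2)
  show "(\<lambda>n. V o\<^sub>L ((s ^ n / fact n) *\<^sub>R v n)) sums (V o\<^sub>L egf v s)"
    by (rule bounded_linear.sums[OF blinfun_compose.bounded_linear_right egf_sums[OF assms(1)]])
  have "(\<lambda>n. ((s ^ n / fact n) *\<^sub>R w n) o\<^sub>L V) sums (egf w s o\<^sub>L V)"
    by (rule bounded_linear.sums[OF blinfun_compose.bounded_linear_left egf_sums[OF assms(2)]])
  then show "(\<lambda>n. V o\<^sub>L ((s ^ n / fact n) *\<^sub>R v n)) sums (egf w s o\<^sub>L V)"
    by (simp add: blinfun_compose.scaleR_left blinfun_compose.scaleR_right assms(3))
qed

text \<open>Passing to scalar series lets inequalities between operator series be checked term by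
  term.\<close>

lemma inner_egf_sums:
  fixes v :: "nat \<Rightarrow> 'a::{real_inner,complete_space} \<Rightarrow>\<^sub>L 'a"
  assumes "geom_bounded v"
  shows "(\<lambda>n. s ^ n / fact n * (x \<bullet> v n y)) sums (x \<bullet> egf v s y)"
proof -
  have "bounded_linear (\<lambda>V::'a \<Rightarrow>\<^sub>L 'a. x \<bullet> V y)"
    by (rule bounded_linear_compose[OF bounded_linear_inner_right blinfun.bounded_linear_left])
  from bounded_linear.sums[OF this egf_sums[OF assms, of s]] show ?thesis
    by (simp add: blinfun.scaleR_left)
qed

section \<open>Hyperbolic functions of an operator\<close>

text \<open>With \<open>r = \<surd>A\<close>, the three functions are \<open>cosh (s r)\<close>, \<open>sinh (s r) / r\<close> and
  \<open>(cosh (s r) - 1) / r\<^sup>2\<close>; they are even in \<open>r\<close>, so no square root is needed.\<close>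

definition cosh_seq :: "('x::real_normed_vector \<Rightarrow>\<^sub>L 'x) \<Rightarrow> nat \<Rightarrow> 'x \<Rightarrow>\<^sub>L 'x" where
  "cosh_seq A n = (if even n then op_pow A (n div 2) else 0)"

definition sinh_seq :: "('x::real_normed_vector \<Rightarrow>\<^sub>L 'x) \<Rightarrow> nat \<Rightarrow> 'x \<Rightarrow>\<^sub>L 'x" where
  "sinh_seq A n = (case n of 0 \<Rightarrow> 0 | Suc m \<Rightarrow> cosh_seq A m)"

definition vers_seq :: "('x::real_normed_vector \<Rightarrow>\<^sub>L 'x) \<Rightarrow> nat \<Rightarrow> 'x \<Rightarrow>\<^sub>L 'x" where
  "vers_seq A n = (case n of 0 \<Rightarrow> 0 | Suc m \<Rightarrow> sinh_seq A m)"

abbreviation "op_cosh A \<equiv> egf (cosh_seq A)"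
abbreviation "op_sinh A \<equiv> egf (sinh_seq A)"
abbreviation "op_vers A \<equiv> egf (vers_seq A)"

lemma geom_bounded_cosh: "geom_bounded (cosh_seq A)"
  unfolding geom_bounded_def
proof (intro exI allI)
  fix n
  have "norm (cosh_seq A n) \<le> norm A ^ (n div 2)"
    by (auto simp: cosh_seq_def norm_op_pow_le)
  also have "\<dots> \<le> (1 + norm A) ^ (n div 2)" by (intro power_mono) auto
  \<comment> \<open>The base is at least 1, so the exponent \<open>n div 2\<close> may be raised to
    \<open>n\<close>.\<close>
  also have "\<dots> \<le> (1 + norm A) ^ n" by (intro power_increasing) auto
  finally show "norm (cosh_seq A n) \<le> 1 * (1 + norm A) ^ n" by simp
qed

lemma geom_bounded_case_nat:
  assumes "geom_bounded v" shows "geom_bounded (\<lambda>n. case n of 0 \<Rightarrow> 0 | Suc m \<Rightarrow> v m)"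
proof -
  obtain K M where KM: "0 \<le> K" "0 \<le> M" "\<And>n. norm (v n) \<le> K * M ^ n"
    using geom_boundedE[OF assms] by blast
  have "norm (case n of 0 \<Rightarrow> 0 | Suc m \<Rightarrow> v m) \<le> K * (1 + M) ^ n" for n
  proof (cases n)
    case (Suc m)
    have "norm (v m) \<le> K * M ^ m" by (rule KM)
    also have "\<dots> \<le> K * (1 + M) ^ m" using KM by (intro mult_left_mono power_mono) auto
    also have "\<dots> \<le> K * (1 + M) ^ Suc m" using KM by (intro mult_left_mono power_increasing) auto
    finally show ?thesis using Suc by simp
  qed (use KM in auto)
  then show ?thesis unfolding geom_bounded_def by blast
qed

lemma geom_bounded_sinh: "geom_bounded (sinh_seq A)"
  using geom_bounded_case_nat[OF geom_bounded_cosh[of A]] by (simp add: sinh_seq_def[abs_def])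

lemma geom_bounded_vers: "geom_bounded (vers_seq A)"
  using geom_bounded_case_nat[OF geom_bounded_sinh[of A]] by (simp add: vers_seq_def[abs_def])

text \<open>Coefficient form of the rule that cosh (s r) has derivative r^2 times sinh (s r) / r,
  with r^2 = A.\<close>

lemma cosh_seq_Suc: "cosh_seq A (Suc n) = A o\<^sub>L sinh_seq A n"
proof (cases n)
  case (Suc m)
  then show ?thesis by (cases "even m") (auto simp: cosh_seq_def sinh_seq_def op_pow_Suc elim!: evenE)
qed (simp_all add: cosh_seq_def sinh_seq_def)

context
  fixes A :: "'x::{real_inner,complete_space} \<Rightarrow>\<^sub>L 'x"
begin

lemma op_cosh_0: "op_cosh A 0 = id_blinfun"
  by (simp add: egf_0[OF geom_bounded_cosh] cosh_seq_def)

lemma op_sinh_0: "op_sinh A 0 = 0"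
  by (simp add: egf_0[OF geom_bounded_sinh] sinh_seq_def)

lemma op_vers_0: "op_vers A 0 = 0"
  by (simp add: egf_0[OF geom_bounded_vers] vers_seq_def)

lemma op_sinh_derivative: "(op_sinh A has_vector_derivative op_cosh A s) (at s)"
  using egf_has_vector_derivative[OF geom_bounded_sinh[of A], of s] by (simp add: sinh_seq_def)

lemma op_vers_derivative: "(op_vers A has_vector_derivative op_sinh A s) (at s)"
  using egf_has_vector_derivative[OF geom_bounded_vers[of A], of s] by (simp add: vers_seq_def)

lemma op_cosh_derivative: "(op_cosh A has_vector_derivative (A o\<^sub>L op_sinh A s)) (at s)"
proof -
  have "egf (\<lambda>n. cosh_seq A (Suc n)) s = A o\<^sub>L op_sinh A s"
  proof (rule sums_unique2[OF egf_sums[OF geom_bounded_Suc[OF geom_bounded_cosh]]])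
    have "(\<lambda>n. A o\<^sub>L ((s ^ n / fact n) *\<^sub>R sinh_seq A n)) sums (A o\<^sub>L op_sinh A s)"
      by (rule bounded_linear.sums[OF blinfun_compose.bounded_linear_right egf_sums[OF geom_bounded_sinh]])
    then show "(\<lambda>n. (s ^ n / fact n) *\<^sub>R cosh_seq A (Suc n)) sums (A o\<^sub>L op_sinh A s)"
      by (simp add: cosh_seq_Suc blinfun_compose.scaleR_right)
  qed
  then show ?thesis using egf_has_vector_derivative[OF geom_bounded_cosh[of A], of s] by simp
qed

text \<open>The multiplied-out form of (cosh - 1) / r^2, meaningful also when \<open>A\<close> is
  not invertible.\<close>

lemma op_vers_eq: "A o\<^sub>L op_vers A s = op_cosh A s - id_blinfun"
proof (rule sums_unique2)
  show "(\<lambda>n. A o\<^sub>L ((s ^ n / fact n) *\<^sub>R vers_seq A n)) sums (A o\<^sub>L op_vers A s)"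
    by (rule bounded_linear.sums[OF blinfun_compose.bounded_linear_right egf_sums[OF geom_bounded_vers]])
  have "A o\<^sub>L ((s ^ n / fact n) *\<^sub>R vers_seq A n)
      = (s ^ n / fact n) *\<^sub>R cosh_seq A n - (if n = 0 then id_blinfun else 0)" for n
    by (cases n) (simp_all add: vers_seq_def cosh_seq_Suc blinfun_compose.scaleR_right cosh_seq_def[of A 0])
  then show "(\<lambda>n. A o\<^sub>L ((s ^ n / fact n) *\<^sub>R vers_seq A n)) sums (op_cosh A s - id_blinfun)"
    by (simp only:) (intro sums_diff egf_sums[OF geom_bounded_cosh] sums_single)
qed

end

lemma op_cosh_intertwine:
  fixes V :: "'x::{real_normed_vector,complete_space} \<Rightarrow>\<^sub>L 'y::{real_normed_vector,complete_space}"
  assumes "V o\<^sub>L A = B o\<^sub>L V"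
  shows "V o\<^sub>L op_cosh A s = op_cosh B s o\<^sub>L V"
  by (rule egf_intertwine[OF geom_bounded_cosh geom_bounded_cosh])
    (simp add: cosh_seq_def op_pow_intertwine[OF assms])

lemma op_sinh_intertwine:
  fixes V :: "'x::{real_normed_vector,complete_space} \<Rightarrow>\<^sub>L 'y::{real_normed_vector,complete_space}"
  assumes "V o\<^sub>L A = B o\<^sub>L V"
  shows "V o\<^sub>L op_sinh A s = op_sinh B s o\<^sub>L V"
  by (rule egf_intertwine[OF geom_bounded_sinh geom_bounded_sinh])
    (simp add: sinh_seq_def cosh_seq_def op_pow_intertwine[OF assms] split: nat.split)

lemma op_vers_intertwine:
  fixes V :: "'x::{real_normed_vector,complete_space} \<Rightarrow>\<^sub>L 'y::{real_normed_vector,complete_space}"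
  assumes "V o\<^sub>L A = B o\<^sub>L V"
  shows "V o\<^sub>L op_vers A s = op_vers B s o\<^sub>L V"
  by (rule egf_intertwine[OF geom_bounded_vers geom_bounded_vers])
    (simp add: vers_seq_def sinh_seq_def cosh_seq_def op_pow_intertwine[OF assms] split: nat.split)

subsection \<open>Positivity\<close>

text \<open>For s \<ge> 0, \<open>egf v s\<close> is then a power series in \<open>A\<close> with
  nonnegative coefficients.\<close>

definition power_seq :: "('x::real_normed_vector \<Rightarrow>\<^sub>L 'x) \<Rightarrow> (nat \<Rightarrow> 'x \<Rightarrow>\<^sub>L 'x) \<Rightarrow> bool" where
  "power_seq A v \<longleftrightarrow> (\<forall>n. v n = 0 \<or> (\<exists>j. v n = op_pow A j))"

lemma power_seq_cosh: "power_seq A (cosh_seq A)"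
  by (auto simp: power_seq_def cosh_seq_def)

lemma power_seq_vers: "power_seq A (vers_seq A)"
  by (auto simp: power_seq_def vers_seq_def sinh_seq_def cosh_seq_def split: nat.split)

text \<open>A product of two positive operators that commute with \<open>A\<close> is positive, but this needs square
  roots. Operators in the following cone can be multiplied by power series in \<open>A\<close> with nonnegative
  coefficients.\<close>

definition power_positive :: "('x::real_inner \<Rightarrow>\<^sub>L 'x) \<Rightarrow> ('x \<Rightarrow>\<^sub>L 'x) \<Rightarrow> bool" where
  "power_positive A V \<longleftrightarrow> (\<forall>k x. 0 \<le> x \<bullet> op_pow A k (V x))"

lemma power_positiveD: "power_positive A V \<Longrightarrow> 0 \<le> x \<bullet> V x"
  unfolding power_positive_def by (metis op_pow_0 blinfun_apply_id_blinfun)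

lemma symmetric_op_egf:
  fixes v :: "nat \<Rightarrow> 'x::{real_inner,complete_space} \<Rightarrow>\<^sub>L 'x"
  assumes v: "geom_bounded v" and sym: "\<And>n. symmetric_op (v n)"
  shows "symmetric_op (egf v s)"
  unfolding symmetric_op_def
proof (intro allI)
  fix x y
  have "(\<lambda>n. s ^ n / fact n * (y \<bullet> v n x)) sums (y \<bullet> egf v s x)" by (rule inner_egf_sums[OF v])
  moreover have "y \<bullet> v n x = x \<bullet> v n y" for n
    using symmetric_opD[OF sym, of n x y] by (simp add: inner_commute)
  ultimately have "(\<lambda>n. s ^ n / fact n * (x \<bullet> v n y)) sums (y \<bullet> egf v s x)" by simp
  from sums_unique2[OF this inner_egf_sums[OF v]]
  show "egf v s x \<bullet> y = x \<bullet> egf v s y" by (simp add: inner_commute)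
qed

context
  fixes A :: "'x::{real_inner,complete_space} \<Rightarrow>\<^sub>L 'x"
  assumes A: "positive_op A"
begin

text \<open>Half of the factors move to the other side of the inner product; an odd exponent leaves
  one \<open>A\<close> in the middle.\<close>

lemma op_pow_nonneg: "0 \<le> x \<bullet> op_pow A n x"
proof -
  note sym = positive_op_symmetric[OF A]
  have sq: "x \<bullet> op_pow A (j + j) x = op_pow A j x \<bullet> op_pow A j x" for j x
    by (simp add: op_pow_add symmetric_opD[OF symmetric_op_pow[OF sym]])
  show ?thesis
  proof (cases "even n")
    case True
    then obtain j where "n = j + j" by (metis evenE mult_2)
    then show ?thesis by (simp add: sq)
  next
    case False
    then obtain j where n: "n = j + (1 + j)" by (metis oddE mult_2 add.assoc add.commute)
    have "x \<bullet> op_pow A n x = op_pow A j x \<bullet> A (op_pow A j x)"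
      unfolding n op_pow_add by (simp add: symmetric_opD[OF symmetric_op_pow[OF sym]] op_pow_Suc)
    then show ?thesis using A by (simp add: positive_op_def)
  qed
qed

lemma power_positive_id: "power_positive A id_blinfun"
  by (simp add: power_positive_def op_pow_nonneg)

lemma inner_power_seq_nonneg:
  assumes "power_seq A v" "power_positive A V"
  shows "0 \<le> op_pow A k x \<bullet> v n (V x)"
proof -
  from assms(1) consider "v n = 0" | j where "v n = op_pow A j" unfolding power_seq_def by blast
  then show ?thesis
  proof cases
    case 2
    have "op_pow A k x \<bullet> v n (V x) = x \<bullet> op_pow A (k + j) (V x)"
      by (simp add: 2 op_pow_add symmetric_opD[OF symmetric_op_pow[OF positive_op_symmetric[OF A]]])
    then show ?thesis using assms(2) by (simp add: power_positive_def)
  qed simp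
qed

lemma power_positive_egf:
  assumes "geom_bounded v" "power_seq A v" "power_positive A V" "0 \<le> s"
  shows "power_positive A (egf v s o\<^sub>L V)"
  unfolding power_positive_def
proof (intro allI)
  fix k x
  have "0 \<le> s ^ n / fact n * (op_pow A k x \<bullet> v n (V x))" for n
    using inner_power_seq_nonneg[OF assms(2,3)] assms(4) by simp
  from sums_le[OF this sums_zero inner_egf_sums[OF assms(1)]]
  have "0 \<le> op_pow A k x \<bullet> egf v s (V x)" .
  then show "0 \<le> x \<bullet> op_pow A k ((egf v s o\<^sub>L V) x)"
    by (simp add: symmetric_opD[OF symmetric_op_pow[OF positive_op_symmetric[OF A]]])
qed

lemma power_positive_cosh: "0 \<le> s \<Longrightarrow> power_positive A (op_cosh A s)"
  using power_positive_egf[OF geom_bounded_cosh power_seq_cosh power_positive_id] by simp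

lemma power_positive_vers: "0 \<le> s \<Longrightarrow> power_positive A (op_vers A s)"
  using power_positive_egf[OF geom_bounded_vers power_seq_vers power_positive_id] by simp

text \<open>All terms are nonnegative, so any finite selection may be kept: {0} yields coercivity,
  and {0, 2 k} the polynomial that dominates a fractional power.\<close>

lemma inner_op_cosh_ge:
  assumes "power_positive A V" "0 \<le> s" "finite N"
  shows "(\<Sum>n\<in>N. s ^ n / fact n * (x \<bullet> cosh_seq A n (V x))) \<le> x \<bullet> op_cosh A s (V x)"
proof -
  have sums: "(\<lambda>n. s ^ n / fact n * (x \<bullet> cosh_seq A n (V x))) sums (x \<bullet> op_cosh A s (V x))"
    by (rule inner_egf_sums[OF geom_bounded_cosh])
  have "0 \<le> s ^ n / fact n * (x \<bullet> cosh_seq A n (V x))" for n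
    using inner_power_seq_nonneg[OF power_seq_cosh assms(1), of 0 x n] assms(2) by simp
  then have "(\<Sum>n\<in>N. s ^ n / fact n * (x \<bullet> cosh_seq A n (V x)))
      \<le> (\<Sum>n. s ^ n / fact n * (x \<bullet> cosh_seq A n (V x)))"
    using sums assms(3) by (intro sum_le_suminf) (auto simp: sums_iff)
  then show ?thesis using sums by (simp add: sums_iff)
qed

lemma op_cosh_coercive: "0 \<le> s \<Longrightarrow> (norm x)\<^sup>2 \<le> x \<bullet> op_cosh A s x"
  using inner_op_cosh_ge[OF power_positive_id, of s "{0}" x]
  by (simp add: cosh_seq_def power2_norm_eq_inner)

text \<open>The scalar inequality (cosh (s r) - 1) / r^2 \<le> s^2 cosh (s r), read off from s^(n+2)
  / (n+2)! \<le> s^2 s^n / n!.\<close>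

lemma inner_op_vers_le:
  assumes "power_positive A V" "0 \<le> s"
  shows "x \<bullet> op_vers A s (V x) \<le> s\<^sup>2 * (x \<bullet> op_cosh A s (V x))"
proof (rule sums_le)
  let ?c = "\<lambda>n. x \<bullet> cosh_seq A n (V x)"
  have "(\<lambda>n. s ^ n / fact n * (x \<bullet> vers_seq A n (V x))) sums (x \<bullet> op_vers A s (V x))"
    by (rule inner_egf_sums[OF geom_bounded_vers])
  \<comment> \<open>The first two vers coefficients vanish; the later ones are the cosh coefficients
    two places back.\<close>
  then have "(\<lambda>n. s ^ (n + 2) / fact (n + 2) * (x \<bullet> vers_seq A (n + 2) (V x))) sums (x \<bullet> op_vers A s (V x))"
    by (subst sums_iff_shift) (simp add: numeral_2_eq_2 vers_seq_def sinh_seq_def)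
  then show "(\<lambda>n. s ^ (n + 2) / fact (n + 2) * ?c n) sums (x \<bullet> op_vers A s (V x))"
    by (simp add: vers_seq_def sinh_seq_def)
  show "(\<lambda>n. s\<^sup>2 * (s ^ n / fact n * ?c n)) sums (s\<^sup>2 * (x \<bullet> op_cosh A s (V x)))"
    by (intro sums_mult inner_egf_sums geom_bounded_cosh)
  fix n
  have "s ^ (n + 2) / fact (n + 2) \<le> s ^ (n + 2) / fact n"
    using assms(2) by (intro divide_left_mono fact_mono) auto
  then have "s ^ (n + 2) / fact (n + 2) * ?c n \<le> s ^ (n + 2) / fact n * ?c n"
    using inner_power_seq_nonneg[OF power_seq_cosh assms(1), of 0 x n] by (intro mult_right_mono) auto
  then show "s ^ (n + 2) / fact (n + 2) * ?c n \<le> s\<^sup>2 * (s ^ n / fact n * ?c n)"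
    by (simp add: power_add power2_eq_square mult_ac)
qed

lemma symmetric_op_cosh: "symmetric_op (op_cosh A s)"
  by (rule symmetric_op_egf[OF geom_bounded_cosh])
    (simp add: cosh_seq_def symmetric_op_pow positive_op_symmetric[OF A], simp add: symmetric_op_def)

lemma symmetric_op_vers: "symmetric_op (op_vers A s)"
  by (rule symmetric_op_egf[OF geom_bounded_vers])
    (auto simp: vers_seq_def sinh_seq_def cosh_seq_def symmetric_op_pow positive_op_symmetric[OF A] symmetric_op_def[of 0]
      split: nat.split)

text \<open>With C = cosh and q the terms 0 and 2 k of its series, q q \<le> C q = q C \<le> C C:
  the form inequality is used once with extra factor q and once with C. Positivity of
  \<open>k\<close> keeps the two indices distinct.\<close>

lemma norm_op_cosh_ge:
  assumes s: "0 \<le> s" and k: "0 < k"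
  shows "norm (op_poly (1 + monom (s ^ (2 * k) / fact (2 * k)) k) A x) \<le> norm (op_cosh A s x)"
proof -
  define q where "q = op_poly (1 + monom (s ^ (2 * k) / fact (2 * k)) k) A"
  have q_apply: "q x = x + (s ^ (2 * k) / fact (2 * k)) *\<^sub>R op_pow A k x" for x
    by (simp add: q_def op_poly_add op_poly_monom one_pCons op_poly_pCons blinfun.bilinear_simps)
  have le: "x \<bullet> q (V x) \<le> x \<bullet> op_cosh A s (V x)" if "power_positive A V" for V x
    using inner_op_cosh_ge[OF that s, of "{0, 2 * k}" x] k
    by (simp add: q_apply cosh_seq_def inner_add_right)
  have qsym: "symmetric_op q"
    unfolding q_def by (rule symmetric_op_poly[OF positive_op_symmetric[OF A]])
  have comm: "op_cosh A s o\<^sub>L q = q o\<^sub>L op_cosh A s"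
    unfolding q_def by (intro op_poly_commute op_cosh_intertwine[symmetric] refl)
  have qpos: "power_positive A q"
  proof -
    have "x \<bullet> op_pow A j (op_pow A k x) \<ge> 0" for j x
      using op_pow_nonneg[of x "j + k"] by (simp add: op_pow_add)
    then show ?thesis
      using s op_pow_nonneg by (simp add: power_positive_def q_apply blinfun.bilinear_simps inner_add_right)
  qed
  have "(norm (q x))\<^sup>2 = x \<bullet> q (q x)" by (simp add: power2_norm_eq_inner symmetric_opD[OF qsym])
  also have "\<dots> \<le> x \<bullet> op_cosh A s (q x)" by (rule le[OF qpos])
  also have "\<dots> = x \<bullet> q (op_cosh A s x)" by (metis comm blinfun_apply_blinfun_compose)
  also have "\<dots> \<le> x \<bullet> op_cosh A s (op_cosh A s x)" by (rule le[OF power_positive_cosh[OF s]])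
  also have "\<dots> = (norm (op_cosh A s x))\<^sup>2" by (simp add: power2_norm_eq_inner symmetric_opD[OF symmetric_op_cosh])
  finally have "norm (q x) \<le> norm (op_cosh A s x)" by (rule power2_le_imp_le) simp
  then show ?thesis by (simp add: q_def)
qed

end

subsection \<open>The hyperbolic secant\<close>

lemma has_vector_derivative_iff_quotient:
  fixes f :: "real \<Rightarrow> 'a::real_normed_vector"
  shows "(f has_vector_derivative f') (at x within S) \<longleftrightarrow>
    ((\<lambda>y. (f y - f x) /\<^sub>R (y - x)) \<longlongrightarrow> f') (at x within S)"
proof -
  have "norm (f y - f x - (y - x) *\<^sub>R f') / norm (y - x) = norm ((f y - f x) /\<^sub>R (y - x) - f')"
    if "y \<noteq> x" for y
  proof -
    have "f y - f x - (y - x) *\<^sub>R f' = (y - x) *\<^sub>R ((f y - f x) /\<^sub>R (y - x) - f')"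
      using that by (simp add: scaleR_diff_right)
    then show ?thesis using that by (simp only: norm_scaleR) simp
  qed
  then have "((\<lambda>y. norm (f y - f x - (y - x) *\<^sub>R f') / norm (y - x)) \<longlongrightarrow> 0) (at x within S) \<longleftrightarrow>
      ((\<lambda>y. norm ((f y - f x) /\<^sub>R (y - x) - f')) \<longlongrightarrow> 0) (at x within S)"
    by (intro tendsto_cong) (simp add: eventually_at_filter)
  then show ?thesis
    by (simp add: has_vector_derivative_def has_derivative_iff_norm bounded_linear_scaleR_left
        tendsto_norm_zero_iff LIM_zero_iff)
qed

text \<open>From D(r) - D(s) = - D(r) (C(r) - C(s)) D(s), the uniform bound first gives continuity
  of D, and then the difference quotient converges. The set K allows one-sided derivatives at the
  end of the half line on which cosh is inverted.\<close>

lemma has_vector_derivative_blinfun_inverse: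
  fixes C D :: "real \<Rightarrow> 'x::real_normed_vector \<Rightarrow>\<^sub>L 'x"
  assumes C: "(C has_vector_derivative C') (at s within K)" and "s \<in> K"
    and inv: "\<And>r. r \<in> K \<Longrightarrow> C r o\<^sub>L D r = id_blinfun" "\<And>r. r \<in> K \<Longrightarrow> D r o\<^sub>L C r = id_blinfun"
    and bound: "\<And>r. r \<in> K \<Longrightarrow> norm (D r) \<le> M"
  shows "(D has_vector_derivative - (D s o\<^sub>L C' o\<^sub>L D s)) (at s within K)"
proof -
  have diff: "D r - D s = - (D r o\<^sub>L (C r - C s) o\<^sub>L D s)" if "r \<in> K" for r
    using that \<open>s \<in> K\<close> inv
    by (simp add: blinfun_compose.diff_left blinfun_compose.diff_right blinfun_compose_assoc)
  have cont: "(C \<longlongrightarrow> C s) (at s within K)"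
    using has_vector_derivative_continuous[OF C] by (simp add: continuous_within)
  have D: "(D \<longlongrightarrow> D s) (at s within K)"
  proof (rule LIM_zero_cancel, rule Lim_null_comparison)
    show "\<forall>\<^sub>F r in at s within K. norm (D r - D s) \<le> M * M * norm (C r - C s)"
      unfolding eventually_at_filter
    proof (intro always_eventually allI impI)
      fix r assume "r \<in> K"
      have "norm (D r - D s) \<le> norm (D r) * norm (C r - C s) * norm (D s)"
        unfolding diff[OF \<open>r \<in> K\<close>] norm_minus_cancel
        by (intro order_trans[OF norm_blinfun_compose] mult_right_mono norm_blinfun_compose) auto
      also have "\<dots> \<le> M * norm (C r - C s) * M"
        using bound[OF \<open>r \<in> K\<close>] bound[OF \<open>s \<in> K\<close>] order_trans[OF norm_ge_zero bound[OF \<open>s \<in> K\<close>]]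
        by (intro mult_mono) auto
      finally show "norm (D r - D s) \<le> M * M * norm (C r - C s)" by (simp add: mult_ac)
    qed
    show "((\<lambda>r. M * M * norm (C r - C s)) \<longlongrightarrow> 0) (at s within K)"
      by (rule tendsto_eq_intros LIM_zero[OF cont] refl | simp)+
  qed
  have "((\<lambda>r. - (D r o\<^sub>L ((C r - C s) /\<^sub>R (r - s)) o\<^sub>L D s)) \<longlongrightarrow> - (D s o\<^sub>L C' o\<^sub>L D s)) (at s within K)"
    using C unfolding has_vector_derivative_iff_quotient by (intro tendsto_intros D)
  then show ?thesis
    unfolding has_vector_derivative_iff_quotient
    by (rule Lim_transform_eventually)
      (auto simp: eventually_at_filter diff blinfun_compose.scaleR_right blinfun_compose.scaleR_left intro!: always_eventually)
qed

text \<open>A two-sided inverse is unique, so the choice is determined; the bound 1 is the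
  reciprocal of the coercivity constant of cosh.\<close>

definition op_sech :: "('x::real_normed_vector \<Rightarrow>\<^sub>L 'x) \<Rightarrow> real \<Rightarrow> 'x \<Rightarrow>\<^sub>L 'x" where
  "op_sech A s = (SOME D. op_cosh A s o\<^sub>L D = id_blinfun \<and> D o\<^sub>L op_cosh A s = id_blinfun \<and> norm D \<le> 1)"

lemma op_sech:
  fixes A :: "'x::{real_inner,complete_space} \<Rightarrow>\<^sub>L 'x"
  assumes "positive_op A" "0 \<le> s"
  shows "op_cosh A s o\<^sub>L op_sech A s = id_blinfun" "op_sech A s o\<^sub>L op_cosh A s = id_blinfun"
    "norm (op_sech A s) \<le> 1"
proof -
  obtain D where "op_cosh A s o\<^sub>L D = id_blinfun" "D o\<^sub>L op_cosh A s = id_blinfun" "norm D \<le> 1"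
    using coercive_invertible[of 1 "op_cosh A s"] op_cosh_coercive[OF assms] by auto
  then have "\<exists>D. op_cosh A s o\<^sub>L D = id_blinfun \<and> D o\<^sub>L op_cosh A s = id_blinfun \<and> norm D \<le> 1"
    by blast
  from someI_ex[OF this] show "op_cosh A s o\<^sub>L op_sech A s = id_blinfun"
    "op_sech A s o\<^sub>L op_cosh A s = id_blinfun" "norm (op_sech A s) \<le> 1"
    unfolding op_sech_def by blast+
qed

lemma op_sech_apply:
  fixes A :: "'x::{real_inner,complete_space} \<Rightarrow>\<^sub>L 'x"
  assumes "positive_op A" "0 \<le> s"
  shows "op_cosh A s (op_sech A s x) = x" "op_sech A s (op_cosh A s x) = x"
  using arg_cong[OF op_sech(1)[OF assms], of "\<lambda>V. blinfun_apply V x"]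
    arg_cong[OF op_sech(2)[OF assms], of "\<lambda>V. blinfun_apply V x"] by simp_all

lemma op_sech_intertwine:
  fixes A :: "'x::{real_inner,complete_space} \<Rightarrow>\<^sub>L 'x" and B :: "'y::{real_inner,complete_space} \<Rightarrow>\<^sub>L 'y"
  assumes "positive_op A" "positive_op B" "0 \<le> s" "V o\<^sub>L op_cosh A s = op_cosh B s o\<^sub>L V"
  shows "V o\<^sub>L op_sech A s = op_sech B s o\<^sub>L V"
proof (rule blinfun_eqI)
  fix x
  have "V (op_sech A s x) = op_sech B s (op_cosh B s (V (op_sech A s x)))"
    using assms by (simp add: op_sech_apply)
  also have "op_cosh B s (V (op_sech A s x)) = V (op_cosh A s (op_sech A s x))"
    using assms(4) by (metis blinfun_apply_blinfun_compose)
  finally show "(V o\<^sub>L op_sech A s) x = (op_sech B s o\<^sub>L V) x"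
    using assms by (simp add: op_sech_apply)
qed

lemma op_sech_derivative:
  fixes A :: "'x::{real_inner,complete_space} \<Rightarrow>\<^sub>L 'x"
  assumes A: "positive_op A" and s: "0 \<le> s"
  shows "(op_sech A has_vector_derivative - (op_sech A s o\<^sub>L (A o\<^sub>L op_sinh A s) o\<^sub>L op_sech A s)) (at s within {0..})"
proof (rule has_vector_derivative_blinfun_inverse[where C = "op_cosh A" and M = 1])
  show "(op_cosh A has_vector_derivative (A o\<^sub>L op_sinh A s)) (at s within {0..})"
    by (rule has_vector_derivative_at_within[OF op_cosh_derivative])
  fix r :: real assume "r \<in> {0..}"
  then have "0 \<le> r" by simp
  from op_sech[OF A this] show "op_cosh A r o\<^sub>L op_sech A r = id_blinfun"
    "op_sech A r o\<^sub>L op_cosh A r = id_blinfun" "norm (op_sech A r) \<le> 1" .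
qed (use s in simp)

section \<open>The Riccati equation\<close>

text \<open>Gronwall: the squared norm of \<open>d\<close> weighted by exp (- 2 L t) has nonpositive
  derivative and starts at 0, so the mean value theorem keeps it at most 0.\<close>

lemma linear_growth_zero:
  fixes d :: "real \<Rightarrow> 'a::real_inner"
  assumes deriv: "\<And>t. t \<in> {0..T} \<Longrightarrow> (d has_vector_derivative d' t) (at t within {0..T})"
    and growth: "\<And>t. t \<in> {0..T} \<Longrightarrow> norm (d' t) \<le> L * norm (d t)"
    and "d 0 = 0" "t \<in> {0..T}"
  shows "d t = 0"
proof (cases "t = 0")
  case False
  then have t: "0 < t" "t \<le> T" using assms(4) by auto
  define g where "g r = exp (- 2 * L * r) * (d r \<bullet> d r)" for r
  define g' where "g' r = exp (- 2 * L * r) * (2 * (d r \<bullet> d' r) - 2 * L * (d r \<bullet> d r))" for r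
  have "(g has_derivative (\<lambda>h. h * g' r)) (at r within {0..t})" if "0 \<le> r" "r \<le> t" for r
  proof -
    have "(d has_vector_derivative d' r) (at r within {0..t})"
      by (rule has_vector_derivative_within_subset[OF deriv]) (use that t in auto)
    then have "((\<lambda>r. d r \<bullet> d r) has_real_derivative d r \<bullet> d' r + d' r \<bullet> d r) (at r within {0..t})"
      using bounded_bilinear.has_vector_derivative[OF bounded_bilinear_inner]
      by (simp add: has_real_derivative_iff_has_vector_derivative)
    then have "(g has_real_derivative g' r) (at r within {0..t})"
      unfolding g_def[abs_def] g'_def
      by (auto intro!: derivative_eq_intros simp: inner_commute algebra_simps)
    then show ?thesis by (simp add: has_field_derivative_def mult.commute[of "g' r"] mult_commute_abs)
  qed
  from mvt_simple[OF t(1) this] obtain r where r: "0 < r" "r < t" "g t - g 0 = (t - 0) * g' r" by auto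
  have "d r \<bullet> d' r \<le> norm (d r) * (L * norm (d r))"
    by (rule order_trans[OF norm_cauchy_schwarz]) (use growth[of r] r t in \<open>auto intro: mult_left_mono\<close>)
  then have "g' r \<le> 0"
    unfolding g'_def by (intro mult_nonneg_nonpos) (auto simp: power2_norm_eq_inner[symmetric] power2_eq_square mult_ac)
  then have "t * g' r \<le> 0" using t by (intro mult_nonneg_nonpos) auto
  then have "g t \<le> g 0" using r(3) by simp
  then have "exp (- 2 * L * t) * (d t \<bullet> d t) \<le> 0" using assms(3) by (simp add: g_def)
  then have "d t \<bullet> d t \<le> 0" by (simp add: mult_le_0_iff)
  then show ?thesis by (metis inner_gt_zero_iff not_le)
qed (use assms(3) in simp)

lemma has_vector_derivative_reflect:
  fixes f :: "real \<Rightarrow> 'a::real_normed_vector"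
  assumes "(f has_vector_derivative f') (at (T - t) within {0..T})"
  shows "((\<lambda>t. f (T - t)) has_vector_derivative - f') (at t within {0..T})"
proof -
  have "((-) T has_vector_derivative (- 1)) (at t within {0..T})"
    by (auto intro!: derivative_eq_intros)
  from vector_diff_chain_within[OF this, of f f'] assms show ?thesis by (simp add: o_def)
qed

lemma norm_bounded_of_derivative:
  fixes Q :: "real \<Rightarrow> 'a::real_normed_vector"
  assumes "\<And>t. t \<in> {0..T} \<Longrightarrow> (Q has_vector_derivative Q' t) (at t within {0..T})"
  obtains M where "\<And>t. t \<in> {0..T} \<Longrightarrow> norm (Q t) \<le> M"
proof -
  have "continuous_on {0..T} Q"
    unfolding continuous_on_eq_continuous_within
    using assms has_vector_derivative_continuous by blast
  then have "bounded (Q ` {0..T})" by (intro compact_imp_bounded compact_continuous_image) auto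
  then obtain M where "\<forall>x\<in>Q ` {0..T}. norm x \<le> M" unfolding bounded_iff by blast
  then show ?thesis by (intro that[of M]) blast
qed

lemma positive_op_adj_comp:
  fixes F :: "'x::{real_inner,complete_space} \<Rightarrow>\<^sub>L 'y::{real_inner,complete_space}"
  shows "positive_op (adj F o\<^sub>L F)" "positive_op (F o\<^sub>L adj F)"
proof -
  show "positive_op (adj F o\<^sub>L F)"
    by (simp add: positive_op_def symmetric_op_def adj_works' flip: adj_works[of F])
  have "F (adj F x) \<bullet> y = x \<bullet> F (adj F y)" "x \<bullet> F (adj F x) = adj F x \<bullet> adj F x" for x y
    by (metis adj_works adj_works', metis adj_works')
  then show "positive_op (F o\<^sub>L adj F)"
    by (simp add: positive_op_def symmetric_op_def)
qed

lemma op_sech_commute: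
  fixes A :: "'x::{real_inner,complete_space} \<Rightarrow>\<^sub>L 'x"
  assumes "positive_op A" "0 \<le> s" "V o\<^sub>L A = A o\<^sub>L V"
  shows "V o\<^sub>L op_sech A s = op_sech A s o\<^sub>L V"
  by (rule op_sech_intertwine[OF assms(1,1,2) op_cosh_intertwine[OF assms(3)]])

text \<open>\<open>Q(t) = B\<^sup>-\<^sup>1\<^sup>/\<^sup>2 tanh ((T - t) B\<^sup>1\<^sup>/\<^sup>2)\<close> with \<open>B = F F\<^sup>*\<close>.\<close>

definition riccati_tanh ::
  "('x::{real_inner,complete_space} \<Rightarrow>\<^sub>L 'y::{real_inner,complete_space}) \<Rightarrow> real \<Rightarrow> real \<Rightarrow> 'y \<Rightarrow>\<^sub>L 'y" where
  "riccati_tanh F T t = op_sinh (F o\<^sub>L adj F) (T - t) o\<^sub>L op_sech (F o\<^sub>L adj F) (T - t)"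

context
  fixes F :: "'x::{real_inner,complete_space} \<Rightarrow>\<^sub>L 'y::{real_inner,complete_space}" and T :: real
  assumes T: "0 < T"
begin

lemma riccati_solution_tanh: "riccati_solution F T (riccati_tanh F T)"
proof -
  define B where "B = F o\<^sub>L adj F"
  have B: "positive_op B" unfolding B_def by (rule positive_op_adj_comp)
  have deriv: "((\<lambda>t. op_sinh B (T - t) o\<^sub>L op_sech B (T - t)) has_vector_derivative
      - id_blinfun + ((op_sinh B (T - t) o\<^sub>L op_sech B (T - t)) o\<^sub>L B o\<^sub>L (op_sinh B (T - t) o\<^sub>L op_sech B (T - t))))
      (at t within {0..T})" if "t \<in> {0..T}" for t
  proof -
    define s where "s = T - t"
    have s: "0 \<le> s" using that by (simp add: s_def)
    have "((\<lambda>s. op_sinh B s o\<^sub>L op_sech B s) has_vector_derivative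
        (op_sinh B s o\<^sub>L - (op_sech B s o\<^sub>L (B o\<^sub>L op_sinh B s) o\<^sub>L op_sech B s)) + (op_cosh B s o\<^sub>L op_sech B s))
        (at s within {0..})"
      by (intro blinfun_compose.has_vector_derivative op_sech_derivative[OF B s]
          has_vector_derivative_at_within[OF op_sinh_derivative])
    \<comment> \<open>In s the tanh quotient satisfies dQ/ds = 1 - Q B Q; reversing time below
      supplies the sign of the Riccati equation.\<close>
    also have "(op_sinh B s o\<^sub>L - (op_sech B s o\<^sub>L (B o\<^sub>L op_sinh B s) o\<^sub>L op_sech B s)) + (op_cosh B s o\<^sub>L op_sech B s)
        = - (- id_blinfun + ((op_sinh B s o\<^sub>L op_sech B s) o\<^sub>L B o\<^sub>L (op_sinh B s o\<^sub>L op_sech B s)))"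
      by (simp add: op_sech[OF B s] blinfun_compose.minus_right blinfun_compose_assoc)
    finally have "((\<lambda>s. op_sinh B s o\<^sub>L op_sech B s) has_vector_derivative
        - (- id_blinfun + ((op_sinh B s o\<^sub>L op_sech B s) o\<^sub>L B o\<^sub>L (op_sinh B s o\<^sub>L op_sech B s))))
        (at (T - t) within {0..T})"
      unfolding s_def by (rule has_vector_derivative_within_subset) auto
    from has_vector_derivative_reflect[OF this] show ?thesis by (simp add: s_def)
  qed
  then show ?thesis
    unfolding riccati_solution_def riccati_tanh_def[abs_def] B_def[symmetric]
    by (auto simp: op_sinh_0)
qed

text \<open>With \<open>s = T - t\<close>, the defect \<open>Z = Q cosh - sinh\<close> of a solution \<open>Q\<close> satisfies the linear
  equation \<open>dZ/ds = - Q B Z\<close>.\<close>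

lemma riccati_solution_unique:
  assumes Q: "riccati_solution F T Q" and t: "t \<in> {0..T}"
  shows "Q t = riccati_tanh F T t"
proof -
  define B where "B = F o\<^sub>L adj F"
  have B: "positive_op B" unfolding B_def by (rule positive_op_adj_comp)
  from Q have dQ: "(Q has_vector_derivative - id_blinfun + (Q t o\<^sub>L B o\<^sub>L Q t)) (at t within {0..T})"
    if "t \<in> {0..T}" for t using that by (simp add: riccati_solution_def B_def)
  have "Q T = 0" using Q by (simp add: riccati_solution_def)
  obtain M where M: "\<And>t. t \<in> {0..T} \<Longrightarrow> norm (Q t) \<le> M"
    using norm_bounded_of_derivative[OF dQ] by blast
  have key: "Q (T - s) (op_cosh B s y) = op_sinh B s y" if s: "s \<in> {0..T}" for s y
  proof -
    define d where "d s = Q (T - s) (op_cosh B s y) - op_sinh B s y" for s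
    define d' where "d' s = - Q (T - s) (B (d s))" for s
    have "d s = 0"
    proof (rule linear_growth_zero[OF _ _ _ s])
      fix s assume s: "s \<in> {0..T}"
      then have "T - s \<in> {0..T}" by auto
      have C: "((\<lambda>s. op_cosh B s y) has_vector_derivative (B o\<^sub>L op_sinh B s) y) (at s within {0..T})"
        by (rule bounded_linear.has_vector_derivative[OF blinfun.bounded_linear_left
            has_vector_derivative_at_within[OF op_cosh_derivative]])
      have S: "((\<lambda>s. op_sinh B s y) has_vector_derivative op_cosh B s y) (at s within {0..T})"
        by (rule bounded_linear.has_vector_derivative[OF blinfun.bounded_linear_left
            has_vector_derivative_at_within[OF op_sinh_derivative]])
      have "((\<lambda>s. Q (T - s)) has_vector_derivative - (- id_blinfun + (Q (T - s) o\<^sub>L B o\<^sub>L Q (T - s))))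
          (at s within {0..T})"
        by (rule has_vector_derivative_reflect[OF dQ[OF \<open>T - s \<in> {0..T}\<close>]])
      from has_vector_derivative_diff[OF blinfun.has_vector_derivative[OF this C] S]
      show "(d has_vector_derivative d' s) (at s within {0..T})"
        unfolding d_def[abs_def] d'_def by (simp add: blinfun.bilinear_simps)
      have "norm (d' s) \<le> norm (Q (T - s)) * (norm B * norm (d s))"
        unfolding d'_def norm_minus_cancel
        by (rule order_trans[OF norm_blinfun]) (intro mult_left_mono norm_blinfun norm_ge_zero)
      also have "\<dots> \<le> M * (norm B * norm (d s))"
        using M[OF \<open>T - s \<in> {0..T}\<close>] by (intro mult_right_mono) auto
      finally show "norm (d' s) \<le> (M * norm B) * norm (d s)" by (simp add: mult.assoc)
    next
      show "d 0 = 0" by (simp add: d_def \<open>Q T = 0\<close> op_sinh_0)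
    qed
    then show ?thesis by (simp add: d_def)
  qed
  show ?thesis
  proof (rule blinfun_eqI)
    fix y
    have s: "T - t \<in> {0..T}" "0 \<le> T - t" using t by auto
    \<comment> \<open>Evaluating at \<open>op_sech B (T - t) y\<close> cancels cosh, so the
      vanishing defect determines Q.\<close>
    show "Q t y = riccati_tanh F T t y"
      using key[OF s(1), of "op_sech B (T - t) y"]
      by (simp add: riccati_tanh_def B_def[symmetric] op_sech_apply[OF B s(2)])
  qed
qed

section \<open>The state equation: uniqueness and explicit solution\<close>

lemma state_solution_unique:
  assumes Q: "riccati_solution F T Q" and u: "state_solution F u0 T y Q u" and v: "state_solution F u0 T y Q v"
    and t: "t \<in> {0..T}"
  shows "u t = v t"
proof -
  have dQ: "(Q has_vector_derivative - id_blinfun + (Q t o\<^sub>L (F o\<^sub>L adj F) o\<^sub>L Q t)) (at t within {0..T})"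
    if "t \<in> {0..T}" for t using that Q by (simp add: riccati_solution_def)
  obtain M where M: "\<And>t. t \<in> {0..T} \<Longrightarrow> norm (Q t) \<le> M"
    using norm_bounded_of_derivative[OF dQ] by blast
  define d' where "d' t = - adj F (Q t (F (u t - v t)))" for t
  have "u t - v t = 0"
  proof (rule linear_growth_zero[OF _ _ _ t])
    fix t assume t: "t \<in> {0..T}"
    have "(u has_vector_derivative (- adj F (Q t (F (u t) - y)))) (at t within {0..T})"
      "(v has_vector_derivative (- adj F (Q t (F (v t) - y)))) (at t within {0..T})"
      using u v t by (auto simp: state_solution_def)
    from has_vector_derivative_diff[OF this]
    show "((\<lambda>t. u t - v t) has_vector_derivative d' t) (at t within {0..T})"
      by (simp add: d'_def blinfun.diff_right)
    have "norm (d' t) \<le> norm (adj F) * (norm (Q t) * (norm F * norm (u t - v t)))"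
      unfolding d'_def norm_minus_cancel
      by (rule order_trans[OF norm_blinfun], rule mult_left_mono, rule order_trans[OF norm_blinfun])
        (intro mult_left_mono norm_blinfun norm_ge_zero)+
    also have "\<dots> \<le> norm (adj F) * (M * (norm F * norm (u t - v t)))"
      using M[OF t] by (intro mult_left_mono mult_right_mono) auto
    finally show "norm (d' t) \<le> (norm (adj F) * M * norm F) * norm (u t - v t)" by (simp add: mult.assoc)
  next
    show "u 0 - v 0 = 0" using u v by (simp add: state_solution_def)
  qed
  then show ?thesis by simp
qed

text \<open>Variation of constants with s = T - t: the propagator is cosh (s r) / cosh (T r), and
  the source term integrates to (cosh (T r) - cosh (s r)) / (r^2 cosh (T r)), a difference of two
  vers values divided by cosh (T r).\<close>

lemma state_solution_tanh:
  fixes y :: 'y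
  defines "A \<equiv> adj F o\<^sub>L F" and "g \<equiv> adj F y"
  shows "state_solution F u0 T y (riccati_tanh F T)
    (\<lambda>t. op_cosh A (T - t) (op_sech A T u0) + op_sech A T (op_vers A T g - op_vers A (T - t) g))"
    (is "state_solution F u0 T y _ ?u")
proof -
  define B where "B = F o\<^sub>L adj F"
  define w0 where "w0 = op_sech A T u0"
  have A: "positive_op A" and B: "positive_op B" unfolding A_def B_def by (rule positive_op_adj_comp)+
  have T0: "0 \<le> T" using T by simp
  have AS: "A o\<^sub>L op_sinh A s = op_sinh A s o\<^sub>L A" for s by (rule op_sinh_intertwine) simp
  have ADx: "A (op_sech A s x) = op_sech A s (A x)" if "0 \<le> s" for s x
    using op_sech_commute[OF A that, of A] by (metis blinfun_apply_blinfun_compose)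
  have SDx: "op_sinh A r (op_sech A s x) = op_sech A s (op_sinh A r x)" if "0 \<le> s" for r s x
    using op_sech_commute[OF A that AS[symmetric]] by (metis blinfun_apply_blinfun_compose)
  have DDx: "op_sech A r (op_sech A s x) = op_sech A s (op_sech A r x)" if "0 \<le> r" "0 \<le> s" for r s x
    using op_sech_commute[OF A that(2) op_sech_commute[OF A that(1), of A, symmetric]]
    by (metis blinfun_apply_blinfun_compose)
  have vers: "A (op_vers A s x) = op_cosh A s x - x" for s x
    using arg_cong[OF op_vers_eq[of A s], of "\<lambda>V. blinfun_apply V x"] by (simp add: blinfun.diff_left)
  have adjB: "adj F o\<^sub>L B = A o\<^sub>L adj F" by (simp add: A_def B_def blinfun_compose_assoc)
  \<comment> \<open>\<open>adj F\<close> turns functions of B into functions of A, so the equation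
    can be solved within the domain space of F.\<close>
  have QA: "adj F (riccati_tanh F T t z) = op_sinh A (T - t) (op_sech A (T - t) (adj F z))"
    if "t \<in> {0..T}" for t z
  proof -
    have s: "0 \<le> T - t" using that by simp
    have "adj F (op_sinh B (T - t) x) = op_sinh A (T - t) (adj F x)" for x
      using op_sinh_intertwine[OF adjB] by (metis blinfun_apply_blinfun_compose)
    moreover have "adj F (op_sech B (T - t) x) = op_sech A (T - t) (adj F x)" for x
      using op_sech_intertwine[OF B A s op_cosh_intertwine[OF adjB]] by (metis blinfun_apply_blinfun_compose)
    ultimately show ?thesis by (simp add: riccati_tanh_def flip: B_def)
  qed
  have "(?u has_vector_derivative - adj F (riccati_tanh F T t (F (?u t) - y))) (at t within {0..T})"
    if t: "t \<in> {0..T}" for t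
  proof -
    define s where "s = T - t"
    have s: "0 \<le> s" using t by (simp add: s_def)
    have eval_deriv: "((\<lambda>s. f s x) has_vector_derivative f' x) (at s within {0..T})"
      if "(f has_vector_derivative f') (at s)" for f :: "real \<Rightarrow> 'x \<Rightarrow>\<^sub>L 'x" and f' x
      by (rule bounded_linear.has_vector_derivative[OF blinfun.bounded_linear_left
            has_vector_derivative_at_within[OF that]])
    have "((\<lambda>s. op_cosh A s w0 + op_sech A T (op_vers A T g - op_vers A s g)) has_vector_derivative
        (A o\<^sub>L op_sinh A s) w0 + op_sech A T (0 - op_sinh A s g)) (at s within {0..T})"
      by (intro has_vector_derivative_add eval_deriv op_cosh_derivative
          bounded_linear.has_vector_derivative[OF blinfun.bounded_linear_right] has_vector_derivative_diff
          has_vector_derivative_const op_vers_derivative)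
    then have "((\<lambda>s. op_cosh A s w0 + op_sech A T (op_vers A T g - op_vers A s g)) has_vector_derivative
        op_sinh A s (A w0) - op_sech A T (op_sinh A s g)) (at (T - t) within {0..T})"
      by (simp add: AS s_def blinfun.minus_right)
    from has_vector_derivative_reflect[OF this]
    have "(?u has_vector_derivative - (op_sinh A s (A w0) - op_sech A T (op_sinh A s g))) (at t within {0..T})"
      by (simp add: w0_def)
    moreover have "adj F (riccati_tanh F T t (F (?u t) - y)) = op_sinh A s (A w0) - op_sech A T (op_sinh A s g)"
    proof -
      have "adj F (F (?u t) - y) = A (?u t) - g" by (simp add: A_def g_def blinfun.diff_right)
      also have "A (?u t) = A (op_cosh A s w0) + op_sech A T (op_cosh A T g - op_cosh A s g)"
        by (simp add: s_def w0_def blinfun.add_right blinfun.diff_right ADx T0 vers)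
      finally have "op_sech A s (adj F (F (?u t) - y))
          = op_sech A s (A (op_cosh A s w0)) + op_sech A s (op_sech A T (op_cosh A T g))
            - op_sech A s (op_sech A T (op_cosh A s g)) - op_sech A s g"
        by (simp add: blinfun.add_right blinfun.diff_right)
      also have "\<dots> = A w0 - op_sech A T g"
        using op_sech_apply[OF A s] op_sech_apply[OF A T0]
        by (simp add: DDx[OF s T0] flip: ADx[OF s])
      \<comment> \<open>This scaled residual is independent of t; up to sign, the velocity is
        \<open>op_sinh A s\<close> applied to a fixed vector.\<close>
      finally have sech: "op_sech A s (adj F (F (?u t) - y)) = A w0 - op_sech A T g" .
      have "adj F (riccati_tanh F T t (F (?u t) - y)) = op_sinh A s (A w0 - op_sech A T g)"
        unfolding QA[OF t] sech[symmetric] by (simp only: s_def)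
      then show ?thesis by (simp only: blinfun.diff_right SDx[OF T0])
    qed
    ultimately show ?thesis by simp
  qed
  moreover have "?u 0 = u0"
    by (simp add: op_sech_apply[OF A T0])
  ultimately show ?thesis by (simp add: state_solution_def)
qed

lemma riccati_reg_eq:
  defines "A \<equiv> adj F o\<^sub>L F"
  shows "riccati_reg F u0 T y = op_sech A T (u0 + op_vers A T (adj F y))"
proof -
  define u where "u t = op_cosh A (T - t) (op_sech A T u0)
    + op_sech A T (op_vers A T (adj F y) - op_vers A (T - t) (adj F y))" for t
  have u: "state_solution F u0 T y (riccati_tanh F T) u"
    unfolding u_def[abs_def] A_def by (rule state_solution_tanh)
  have "riccati_reg F u0 T y = u T"
    unfolding riccati_reg_def
  proof (rule the_equality)
    show "\<exists>Q v. riccati_solution F T Q \<and> state_solution F u0 T y Q v \<and> u T = v T"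
      using riccati_solution_tanh u by blast
  next
    fix x assume "\<exists>Q v. riccati_solution F T Q \<and> state_solution F u0 T y Q v \<and> x = v T"
    then obtain Q v where Q: "riccati_solution F T Q" and v: "state_solution F u0 T y Q v" and x: "x = v T"
      by blast
    \<comment> \<open>The state equation reads Q only on [0, T], where Q is already
      identified.\<close>
    have "state_solution F u0 T y (riccati_tanh F T) v"
      using v riccati_solution_unique[OF Q] by (simp add: state_solution_def)
    from state_solution_unique[OF riccati_solution_tanh this u] T x show "x = u T" by simp
  qed
  also have "\<dots> = op_sech A T (u0 + op_vers A T (adj F y))"
    by (simp add: u_def op_cosh_0 op_vers_0 blinfun.add_right)
  finally show ?thesis .
qed

end

section \<open>Error estimates\<close>

lemma symmetric_op_sech:
  fixes A :: "'x::{real_inner,complete_space} \<Rightarrow>\<^sub>L 'x"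
  assumes "positive_op A" "0 \<le> s"
  shows "symmetric_op (op_sech A s)"
  unfolding symmetric_op_def
proof (intro allI)
  fix x y
  have "op_sech A s x \<bullet> y = op_sech A s x \<bullet> op_cosh A s (op_sech A s y)"
    by (simp add: op_sech_apply[OF assms])
  also have "\<dots> = x \<bullet> op_sech A s y"
    unfolding symmetric_opD[OF symmetric_op_cosh[OF assms(1)], symmetric] by (simp only: op_sech_apply[OF assms])
  finally show "op_sech A s x \<bullet> y = x \<bullet> op_sech A s y" .
qed

text \<open>The two summands bound the cases m \<le> 1 and m > 1.\<close>

lemma powr_le_one_plus_power:
  fixes m :: real
  assumes "0 \<le> m" "0 < \<mu>" "\<mu> \<le> real k"
  shows "m powr \<mu> \<le> 1 + m ^ k"
proof (cases "m \<le> 1")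
  case True
  then have "m powr \<mu> \<le> 1 powr \<mu>" using assms by (intro powr_mono2) auto
  then show ?thesis using assms(1) by (simp add: add_increasing2)
next
  case False
  then have "m powr \<mu> \<le> m powr real k" using assms by (intro powr_mono) auto
  then show ?thesis using False by (simp add: powr_realpow)
qed

context
  fixes A :: "'x::{real_inner,complete_space} \<Rightarrow>\<^sub>L 'x"
  assumes A: "positive_op A"
begin

text \<open>Scaling m = l T^2 extracts T^(-2 \<mu>) and leaves m^\<mu> \<le> 1 + m^k, a multiple of
  which is the partial cosh series. Commuting the power past sech makes it act on sech w, where cosh
  undoes sech.\<close>

lemma norm_op_sech_powr_le:
  assumes \<mu>: "0 < \<mu>" and k: "\<mu> \<le> real k" and T: "0 < T"
  shows "norm (op_sech A T (op_powr A \<mu> w)) \<le> fact (2 * k) * T powr (- 2 * \<mu>) * norm w"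
proof -
  have T0: "0 \<le> T" and k0: "0 < k" using \<mu> k T by auto
  define c where "c = fact (2 * k) * T powr (- 2 * \<mu>)"
  define q :: "real poly" where "q = 1 + monom (T ^ (2 * k) / fact (2 * k)) k"
  have cont: "continuous_on {0..norm A} (\<lambda>x. x powr \<mu>)"
    using \<mu> by (intro continuous_on_powr' continuous_intros) auto
  have le: "\<bar>l powr \<mu>\<bar> \<le> poly (smult c q) l" if "l \<in> {0..norm A}" for l
  proof -
    have l: "0 \<le> l" using that by simp
    have "(l * T\<^sup>2) powr \<mu> = l powr \<mu> * T powr (2 * \<mu>)"
      using l T by (simp add: powr_mult powr_powr flip: powr_numeral)
    then have "l powr \<mu> = T powr (- 2 * \<mu>) * (l * T\<^sup>2) powr \<mu>"
      using T by (simp add: powr_minus)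
    also have "\<dots> \<le> T powr (- 2 * \<mu>) * (1 + (l * T\<^sup>2) ^ k)"
      using powr_le_one_plus_power[OF _ \<mu> k, of "l * T\<^sup>2"] l by (intro mult_left_mono) auto
    \<comment> \<open>Enlarging 1 to (2 k)! lets (2 k)! be factored out, leaving the cosh
      coefficient T^(2 k) / (2 k)!.\<close>
    also have "\<dots> \<le> T powr (- 2 * \<mu>) * (fact (2 * k) + (l * T\<^sup>2) ^ k)"
      by (intro mult_left_mono add_right_mono) (auto simp: fact_ge_1)
    also have "\<dots> = poly (smult c q) l"
      by (simp add: c_def q_def poly_monom power_mult_distrib distrib_left mult_ac flip: power_mult)
    finally show ?thesis by simp
  qed
  have comm: "op_sech A T o\<^sub>L op_powr A \<mu> = op_powr A \<mu> o\<^sub>L op_sech A T"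
    unfolding op_powr_def
    by (rule op_fun_commute[OF A cont op_sech_commute[OF A T0, of A, symmetric]]) simp
  have "norm (op_sech A T (op_powr A \<mu> w)) = norm (op_powr A \<mu> (op_sech A T w))"
    by (metis comm blinfun_apply_blinfun_compose)
  also have "\<dots> \<le> norm (op_poly (smult c q) A (op_sech A T w))"
    unfolding op_powr_def by (rule norm_op_fun_apply_le[OF A cont le])
  also have "\<dots> = c * norm (op_poly q A (op_sech A T w))"
    by (simp add: op_poly_smult blinfun.scaleR_left c_def)
  also have "\<dots> \<le> c * norm (op_cosh A T (op_sech A T w))"
    unfolding q_def by (intro mult_left_mono norm_op_cosh_ge[OF A T0 k0]) (simp add: c_def)
  finally show ?thesis by (simp add: op_sech_apply[OF A T0] c_def)
qed

text \<open>Already the term T^2 A / 2 of cosh dominates A; the constant 2 is 2!.\<close>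

lemma norm_op_sech_apply_le:
  assumes T: "0 < T"
  shows "norm (op_sech A T (A w)) \<le> 2 / T\<^sup>2 * norm w"
proof -
  have T0: "0 \<le> T" using T by simp
  let ?p = "monom (T\<^sup>2 / 2) 1 :: real poly"
  have "T\<^sup>2 / 2 * norm (A (op_sech A T w)) = norm (op_poly ?p A (op_sech A T w))"
    by (simp add: op_poly_monom op_pow_Suc blinfun.scaleR_left)
  also have "\<dots> \<le> norm (op_poly (1 + ?p) A (op_sech A T w))"
    by (rule norm_op_poly_apply_mono[OF A]) (simp add: poly_monom)
  also have "\<dots> \<le> norm (op_cosh A T (op_sech A T w))"
    using norm_op_cosh_ge[OF A T0, of 1] by (simp add: fact_2)
  also have "\<dots> = norm w" by (simp add: op_sech_apply[OF A T0])
  finally have "norm (A (op_sech A T w)) \<le> 2 / T\<^sup>2 * norm w" using T by (simp add: field_simps)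
  moreover have "op_sech A T (A w) = A (op_sech A T w)"
    using op_sech_commute[OF A T0, of A] by (metis blinfun_apply_blinfun_compose)
  ultimately show ?thesis by simp
qed

text \<open>Density argument: decay on the range of \<open>A\<close> extends to its closure because
  sech has norm at most 1 uniformly in T.\<close>

lemma op_sech_tendsto_0:
  assumes "v \<in> closure (range (blinfun_apply A))"
  shows "((\<lambda>T. norm (op_sech A T v)) \<longlongrightarrow> 0) at_top"
proof (rule tendstoI)
  fix e :: real assume e: "0 < e"
  then obtain w where w: "norm (v - A w) < e / 2"
    using assms closure_approachable[of v "range (blinfun_apply A)"]
    by (auto simp: dist_norm norm_minus_commute dest: spec[of _ "e / 2"])
  have "((\<lambda>T. 2 / T\<^sup>2 * norm w) \<longlongrightarrow> 0) at_top" 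
    by (intro tendsto_mult_left_zero tendsto_divide_0[OF tendsto_const]
        filterlim_at_top_imp_at_infinity filterlim_pow_at_top filterlim_ident) simp
  then have "\<forall>\<^sub>F T in at_top. 2 / T\<^sup>2 * norm w < e / 2"
    by (rule order_tendstoD(2)) (use e in simp)
  then show "\<forall>\<^sub>F T in at_top. dist (norm (op_sech A T v)) 0 < e"
    using eventually_gt_at_top[of 0]
  proof eventually_elim
    case (elim T)
    have "norm (op_sech A T (v - A w)) \<le> 1 * norm (v - A w)"
      using elim by (intro order_trans[OF norm_blinfun] mult_right_mono op_sech[OF A]) auto
    then have "norm (op_sech A T v) \<le> norm (v - A w) + norm (op_sech A T (A w))"
      using norm_triangle_ineq[of "op_sech A T (v - A w)" "op_sech A T (A w)"]
      by (simp add: blinfun.diff_right)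
    then show ?case using norm_op_sech_apply_le[of T w] elim w by simp
  qed
qed

end

section \<open>Closed range, Moore-Penrose inverse and propagation of data errors\<close>

context
  fixes F :: "'x::{real_inner,complete_space} \<Rightarrow>\<^sub>L 'y::{real_inner,complete_space}"
begin

lemma adj_comp_eq_0: "adj F (F x) = 0 \<Longrightarrow> F x = 0"
  using adj_works[of F x "F x"] by simp

text \<open>The residual z of projecting v onto the closed range R is orthogonal to R, so A z = 0 by
  symmetry and F z = 0. Then z is orthogonal to v and to v - z, hence z = 0.\<close>

lemma orthogonal_null_in_closure:
  assumes v: "v \<in> {x. F x = 0}\<^sup>\<bottom>"
  shows "v \<in> closure (range (blinfun_apply (adj F o\<^sub>L F)))"
proof -
  define A where "A = adj F o\<^sub>L F"
  define R where "R = closure (range (blinfun_apply A))"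
  note sym = positive_op_symmetric[OF positive_op_adj_comp(1)[of F], folded A_def]
  have "0 \<in> range (blinfun_apply A)" by (rule range_eqI[of _ _ 0]) simp
  then have R0: "0 \<in> R" unfolding R_def by (rule subsetD[OF closure_subset])
  \<comment> \<open>Translation by \<open>- A w\<close> maps the range onto itself and therefore its
    closure too, so perturbed residuals remain admissible.\<close>
  have R_diff: "x - A w \<in> R" if "x \<in> R" for x w
  proof -
    have "(+) (- A w) ` range (blinfun_apply A) = range (blinfun_apply A)"
    proof (intro antisym subsetI)
      fix x assume "x \<in> range (blinfun_apply A)"
      then obtain v where "x = A v" by blast
      then have "x = - A w + A (v + w)" by (simp add: blinfun.add_right)
      then show "x \<in> (+) (- A w) ` range (blinfun_apply A)" by blast
    next
      fix x assume "x \<in> (+) (- A w) ` range (blinfun_apply A)"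
      then obtain v where "x = - A w + A v" by blast
      then have "x = A (v - w)" by (simp add: blinfun.diff_right)
      then show "x \<in> range (blinfun_apply A)" by blast
    qed
    then have "(+) (- A w) ` R = R" using closure_translation[of "- A w" "range (blinfun_apply A)"]
      by (simp add: R_def)
    then show ?thesis using that by force
  qed
  have convex: "convex R"
    unfolding R_def by (intro convex_closure convex_linear_image) (auto intro: bounded_linear.linear blinfun.bounded_linear_right)
  obtain z where z: "v - z \<in> R" "\<And>x. v - x \<in> R \<Longrightarrow> norm z \<le> norm x"
  proof (rule closed_convex_min_norm[of "(\<lambda>x. v - x) -` R"])
    show "closed ((\<lambda>x. v - x) -` R)"
      unfolding R_def by (intro continuous_closed_vimage closed_closure) auto
    show "convex ((\<lambda>x. v - x) -` R)"
    proof (rule convexI)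
      fix x y and a b :: real assume xy: "x \<in> (\<lambda>x. v - x) -` R" "y \<in> (\<lambda>x. v - x) -` R" and ab0: "0 \<le> a" "0 \<le> b" and ab: "a + b = 1"
      have "v - (a *\<^sub>R x + b *\<^sub>R y) = a *\<^sub>R (v - x) + b *\<^sub>R (v - y)"
        using ab by (simp add: scaleR_diff_right algebra_simps flip: scaleR_left_distrib)
      then show "a *\<^sub>R x + b *\<^sub>R y \<in> (\<lambda>x. v - x) -` R"
        using convexD[OF convex, of "v - x" "v - y" a b] xy ab ab0 by simp
    qed
    have "v \<in> (\<lambda>x. v - x) -` R" using R0 by simp
    then show "(\<lambda>x. v - x) -` R \<noteq> {}" by blast
  qed auto
  have zA: "z \<bullet> A w = 0" for w
  proof (rule min_norm_orthogonal, rule z(2))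
    fix t
    from R_diff[OF z(1), of "t *\<^sub>R w"] show "v - (z + t *\<^sub>R A w) \<in> R"
      by (simp add: blinfun.scaleR_right algebra_simps)
  qed
  have "A z = 0" using zA[of "A z"] symmetric_opD[OF sym, of z "A z"] by simp
  then have "F z = 0" using adj_comp_eq_0 by (simp add: A_def)
  then have "z \<bullet> v = 0" using v by (simp add: orthogonal_comp_def orthogonal_def)
  moreover have "R \<subseteq> {x. z \<bullet> x = 0}"
    unfolding R_def using zA by (intro closure_minimal closed_Collect_eq continuous_intros) auto
  then have "z \<bullet> (v - z) = 0" using z(1) by blast
  ultimately have "z = 0" by (simp add: inner_diff_right)
  then show ?thesis using z(1) by (simp add: R_def A_def)
qed

text \<open>By Pythagoras the least squares solutions form the affine set F u = F x0, whose minimum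
  norm element is orthogonal to the null space. Only these two properties of the inverse enter the
  convergence proof.\<close>

lemma mp_inverse_works:
  assumes "y \<in> mp_domain F"
  shows "adj F (F (mp_inverse F y)) = adj F y" "mp_inverse F y \<in> {x. F x = 0}\<^sup>\<bottom>"
proof -
  obtain x0 b where y: "y = F x0 + b" and b: "b \<in> (range (blinfun_apply F))\<^sup>\<bottom>"
    using assms unfolding mp_domain_def by blast
  have orth: "F x \<bullet> b = 0" for x using b by (simp add: orthogonal_comp_def orthogonal_def)
  have "norm (F v - y) ^ 2 = norm (F v - F x0) ^ 2 + norm b ^ 2" for v
    using orth[of "v - x0"] unfolding y power2_norm_eq_inner
    by (simp add: blinfun.diff_right inner_simps inner_commute)
  moreover have "norm (F u - y) \<le> norm (F v - y) \<longleftrightarrow> norm (F u - y) ^ 2 \<le> norm (F v - y) ^ 2" for u v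
    by (simp add: power_mono_iff)
  ultimately have lss_iff: "least_squares_solution F y u \<longleftrightarrow> (\<forall>v. norm (F u - F x0) ^ 2 \<le> norm (F v - F x0) ^ 2)" for u
    by (simp add: least_squares_solution_def)
  have lss: "least_squares_solution F y u \<longleftrightarrow> F u = F x0" for u
  proof
    assume "least_squares_solution F y u"
    then have "norm (F u - F x0) ^ 2 \<le> norm (F x0 - F x0) ^ 2" unfolding lss_iff by blast
    then show "F u = F x0" by simp
  qed (simp add: lss_iff)
  let ?K = "{u. F u = F x0}"
  have conv: "convex ?K"
    by (auto simp: convex_def blinfun.add_right blinfun.scaleR_right simp flip: scaleR_left_distrib)
  have closed: "closed ?K" by (intro closed_Collect_eq continuous_intros)
  obtain z where z: "F z = F x0" "\<And>u. F u = F x0 \<Longrightarrow> norm z \<le> norm u"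
    by (rule closed_convex_min_norm[OF closed conv]) auto
  have eq: "mp_inverse F y = z"
    unfolding mp_inverse_def lss
  proof (rule the_equality)
    fix u assume u: "F u = F x0 \<and> (\<forall>v. F v = F x0 \<longrightarrow> norm u \<le> norm v)"
    show "u = z"
      by (rule min_norm_unique[OF conv]) (use z u in \<open>auto intro: antisym\<close>)
  qed (use z in blast)
  have "(norm (adj F b))\<^sup>2 = 0"
    unfolding power2_norm_eq_inner by (subst adj_works[symmetric]) (rule orth)
  then show "adj F (F (mp_inverse F y)) = adj F y"
    unfolding eq z(1) by (simp add: y blinfun.add_right)
  have "w \<bullet> z = 0" if "F w = 0" for w
  proof -
    have "z \<bullet> w = 0"
      by (rule min_norm_orthogonal, rule z(2)) (simp add: blinfun.add_right blinfun.scaleR_right that z(1))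
    then show ?thesis by (simp add: inner_commute)
  qed
  then show "mp_inverse F y \<in> {x. F x = 0}\<^sup>\<bottom>"
    by (simp add: eq orthogonal_comp_def orthogonal_def)
qed

context
  fixes T :: real
  assumes T: "0 < T"
begin

text \<open>With H = vers and C = cosh, squaring gives H A H = H (C - 1) \<le> H C \<le> T^2
  C^2.\<close>

lemma norm_range_op_vers_le: "norm (F (op_vers (adj F o\<^sub>L F) T x)) \<le> T * norm (op_cosh (adj F o\<^sub>L F) T x)"
proof -
  define A where "A = adj F o\<^sub>L F"
  have A: "positive_op A" unfolding A_def by (rule positive_op_adj_comp)
  have T0: "0 \<le> T" using T by simp
  let ?C = "op_cosh A T" and ?H = "op_vers A T"
  have "(norm (F (?H x)))\<^sup>2 = ?H x \<bullet> A (?H x)"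
    by (simp add: power2_norm_eq_inner A_def adj_works)
  also have "A (?H x) = ?C x - x"
    using arg_cong[OF op_vers_eq[of A T], of "\<lambda>V. blinfun_apply V x"] by (simp add: blinfun.diff_left)
  also have "?H x \<bullet> (?C x - x) = x \<bullet> ?H (?C x) - x \<bullet> ?H x"
    by (simp add: inner_diff_right symmetric_opD[OF symmetric_op_vers[OF A]] blinfun.diff_right)
  also have "\<dots> \<le> x \<bullet> ?H (?C x)"
    using power_positiveD[OF power_positive_vers[OF A T0]] by simp
  also have "\<dots> \<le> T\<^sup>2 * (x \<bullet> ?C (?C x))"
    by (rule inner_op_vers_le[OF A power_positive_cosh[OF A T0] T0])
  also have "\<dots> = (T * norm (?C x))\<^sup>2"
    by (simp add: power_mult_distrib power2_norm_eq_inner symmetric_opD[OF symmetric_op_cosh[OF A]])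
  finally show ?thesis unfolding A_def by (rule power2_le_imp_le) (use T in simp)
qed

text \<open>Duality: the operator applied to z is the adjoint of F vers sech, whose norm is at most
  T by the preceding bound.\<close>

lemma norm_noise_amplification_le: "norm (op_sech (adj F o\<^sub>L F) T (op_vers (adj F o\<^sub>L F) T (adj F z))) \<le> T * norm z"
proof -
  define A where "A = adj F o\<^sub>L F"
  have A: "positive_op A" unfolding A_def by (rule positive_op_adj_comp)
  have T0: "0 \<le> T" using T by simp
  define w where "w = op_sech A T (op_vers A T (adj F z))"
  have "norm w * norm w = op_sech A T (op_vers A T (adj F z)) \<bullet> w"
    by (simp add: w_def power2_norm_eq_inner flip: power2_eq_square)
  also have "\<dots> = adj F z \<bullet> op_vers A T (op_sech A T w)"
    by (simp only: symmetric_opD[OF symmetric_op_sech[OF A T0]] symmetric_opD[OF symmetric_op_vers[OF A]])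
  also have "\<dots> = z \<bullet> F (op_vers A T (op_sech A T w))" by (rule adj_works')
  also have "\<dots> \<le> norm z * norm (F (op_vers A T (op_sech A T w)))" by (rule norm_cauchy_schwarz)
  also have "\<dots> \<le> norm z * (T * norm (op_cosh A T (op_sech A T w)))"
    unfolding A_def by (intro mult_left_mono norm_range_op_vers_le) simp
  also have "\<dots> = (T * norm z) * norm w" by (simp add: op_sech_apply[OF A T0])
  finally have "norm w \<le> T * norm z"
    using T by (cases "w = 0") (simp_all add: mult_le_cancel_right)
  then show ?thesis by (simp add: w_def A_def)
qed

text \<open>The normal equation makes u reproduce itself when it is used as initial guess with data
  y. Subtracting that identity separates bias from noise.\<close>

lemma riccati_reg_error:
  assumes u: "adj F (F u) = adj F y"
  shows "norm (riccati_reg F u0 T z - u) \<le> norm (op_sech (adj F o\<^sub>L F) T (u0 - u)) + T * norm (z - y)"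
proof -
  define A where "A = adj F o\<^sub>L F"
  have A: "positive_op A" unfolding A_def by (rule positive_op_adj_comp)
  have T0: "0 \<le> T" using T by simp
  have "op_vers A T (A u) = A (op_vers A T u)"
    using op_vers_intertwine[of A A A T] by (metis blinfun_apply_blinfun_compose)
  also have "\<dots> = op_cosh A T u - u"
    using arg_cong[OF op_vers_eq[of A T], of "\<lambda>V. blinfun_apply V u"] by (simp add: blinfun.diff_left)
  finally have "u = op_sech A T (u + op_vers A T (adj F y))"
    using u op_sech_apply(2)[OF A T0, of u] by (simp add: A_def)
  then have "riccati_reg F u0 T z - u
      = op_sech A T (u0 + op_vers A T (adj F z)) - op_sech A T (u + op_vers A T (adj F y))"
    using riccati_reg_eq[OF T, of F u0 z] by (simp add: A_def)
  also have "\<dots> = op_sech A T (u0 - u) + op_sech A T (op_vers A T (adj F (z - y)))"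
    by (simp add: blinfun.add_right blinfun.diff_right)
  finally have eq: "riccati_reg F u0 T z - u
      = op_sech A T (u0 - u) + op_sech A T (op_vers A T (adj F (z - y)))" .
  show ?thesis
    unfolding eq A_def by (rule order_trans[OF norm_triangle_ineq add_left_mono[OF norm_noise_amplification_le]])
qed

end

lemma riccati_reg_regularization:
  assumes u0: "u0 \<in> {x. F x = 0}\<^sup>\<bottom>"
  shows "regularization_operator F (riccati_reg F u0)"
  unfolding regularization_operator_def
proof (intro conjI ballI allI impI)
  fix T :: real assume "0 < T"
  then have "riccati_reg F u0 T = (\<lambda>y. op_sech (adj F o\<^sub>L F) T (u0 + op_vers (adj F o\<^sub>L F) T (adj F y)))"
    using riccati_reg_eq by blast
  then show "continuous_on UNIV (riccati_reg F u0 T)" by (auto intro!: continuous_intros)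
next
  fix y assume y: "y \<in> mp_domain F"
  define A where "A = adj F o\<^sub>L F"
  have A: "positive_op A" unfolding A_def by (rule positive_op_adj_comp)
  define u where "u = mp_inverse F y"
  \<comment> \<open>The rule T = \<delta>^(-1/2), independent of the data, tends to infinity while
    the noise term T \<delta> = sqrt \<delta> vanishes. The value 1 elsewhere keeps it
    positive.\<close>
  define \<tau> :: "real \<Rightarrow> real" where "\<tau> \<delta> = (if 0 < \<delta> then inverse (sqrt \<delta>) else 1)" for \<delta>
  have \<tau>_pos: "0 < \<tau> \<delta>" for \<delta> by (simp add: \<tau>_def)
  have pos: "\<forall>\<^sub>F \<delta> in at_right (0::real). 0 < \<delta>" by (simp add: eventually_at_right_less)
  have \<tau>_top: "filterlim \<tau> at_top (at_right 0)"
  proof (rule filterlim_mono_eventually[OF _ order_refl order_refl])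
    have "((\<lambda>\<delta>. sqrt \<delta>) \<longlongrightarrow> 0) (at_right 0)" by (auto intro!: tendsto_eq_intros)
    then show "filterlim (\<lambda>\<delta>. inverse (sqrt \<delta>)) at_top (at_right 0)"
      by (rule filterlim_inverse_at_top) (use pos in eventually_elim, simp)
    show "\<forall>\<^sub>F \<delta> in at_right 0. inverse (sqrt \<delta>) = \<tau> \<delta>"
      using pos by eventually_elim (simp add: \<tau>_def)
  qed
  let ?err = "\<lambda>\<delta>. SUP z\<in>{z. norm (z - y) \<le> \<delta>}. ereal (norm (riccati_reg F u0 (\<tau> \<delta>) z - u))"
  let ?b = "\<lambda>\<delta>. norm (op_sech A (\<tau> \<delta>) (u0 - u)) + sqrt \<delta>"
  have "u0 - u \<in> {x. F x = 0}\<^sup>\<bottom>"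
    unfolding u_def using subspace_orthogonal_comp by (intro subspace_diff u0 mp_inverse_works(2)[OF y])
  then have "((\<lambda>\<delta>. norm (op_sech A (\<tau> \<delta>) (u0 - u))) \<longlongrightarrow> 0) (at_right 0)"
    unfolding A_def
    by (intro filterlim_compose[OF op_sech_tendsto_0[OF positive_op_adj_comp(1)] \<tau>_top]
        orthogonal_null_in_closure)
  moreover have "((\<lambda>\<delta>. sqrt \<delta>) \<longlongrightarrow> 0) (at_right 0)" by (auto intro!: tendsto_eq_intros)
  ultimately have "(?b \<longlongrightarrow> 0) (at_right 0)" by (rule tendsto_add_zero)
  then have b: "((\<lambda>\<delta>. ereal (?b \<delta>)) \<longlongrightarrow> 0) (at_right 0)" by (simp add: zero_ereal_def)
  have err: "(?err \<longlongrightarrow> 0) (at_right 0)"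
  proof (rule tendsto_sandwich[OF _ _ tendsto_const b])
    show "\<forall>\<^sub>F \<delta> in at_right 0. 0 \<le> ?err \<delta>"
      using pos by eventually_elim (rule SUP_upper2[of y], auto)
    show "\<forall>\<^sub>F \<delta> in at_right 0. ?err \<delta> \<le> ereal (?b \<delta>)"
      using pos
    proof eventually_elim
      case (elim \<delta>)
      show ?case
      proof (rule SUP_least)
        fix z assume "z \<in> {z. norm (z - y) \<le> \<delta>}"
        then have "\<tau> \<delta> * norm (z - y) \<le> \<tau> \<delta> * \<delta>"
          using \<tau>_pos[of \<delta>] by (intro mult_left_mono) auto
        also have "\<tau> \<delta> * \<delta> = sqrt \<delta>"
          using elim by (simp add: \<tau>_def field_simps flip: power2_eq_square)
        finally show "ereal (norm (riccati_reg F u0 (\<tau> \<delta>) z - u)) \<le> ereal (?b \<delta>)"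
          using riccati_reg_error[OF \<tau>_pos[of \<delta>] mp_inverse_works(1)[OF y], of u0 z]
          by (simp add: A_def u_def)
      qed
    qed
  qed
  have "((\<lambda>\<delta>. ereal (\<tau> \<delta>)) \<longlongrightarrow> \<infinity>) (at_right 0)"
    using \<tau>_top by (simp add: tendsto_PInfty_eq_at_top)
  moreover have "\<forall>\<^sub>F \<delta> in at_right 0. ereal (\<tau> \<delta>) = (INF z\<in>{z. norm (z - y) \<le> \<delta>}. ereal (\<tau> \<delta>))"
    using pos
  proof eventually_elim
    case (elim \<delta>)
    then have "y \<in> {z. norm (z - y) \<le> \<delta>}" by simp
    then show ?case by (subst INF_const) blast+
  qed
  ultimately have inf: "((\<lambda>\<delta>. INF z\<in>{z. norm (z - y) \<le> \<delta>}. ereal (\<tau> \<delta>)) \<longlongrightarrow> \<infinity>) (at_right 0)"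
    by (rule Lim_transform_eventually)
  show "\<exists>T :: real \<Rightarrow> 'y \<Rightarrow> real. (\<forall>\<delta>>0. \<forall>z. T \<delta> z > 0) \<and>
      ((\<lambda>\<delta>. SUP z\<in>{z. norm (z - y) \<le> \<delta>}. ereal (norm (riccati_reg F u0 (T \<delta> z) z - mp_inverse F y)))
        \<longlongrightarrow> 0) (at_right 0) \<and>
      ((\<lambda>\<delta>. INF z\<in>{z. norm (z - y) \<le> \<delta>}. ereal (T \<delta> z)) \<longlongrightarrow> \<infinity>) (at_right 0)"
    using err inf \<tau>_pos by (intro exI[of _ "\<lambda>\<delta> z. \<tau> \<delta>"]) (simp add: u_def)
qed

lemma riccati_reg_rate:
  assumes \<mu>: "0 < \<mu>" and source: "source_condition F \<mu> (u - u0)"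
  obtains C where "0 \<le> C"
    "\<And>T z. 0 < T \<Longrightarrow> norm (riccati_reg F u0 T z - u) \<le> C * T powr (- 2 * \<mu>) + norm (F u - z) * T"
proof -
  define A where "A = adj F o\<^sub>L F"
  have A: "positive_op A" unfolding A_def by (rule positive_op_adj_comp)
  define k where "k = nat \<lceil>\<mu>\<rceil>"
  have k: "\<mu> \<le> real k" unfolding k_def by (rule real_nat_ceiling_ge)
  obtain w where w: "u - u0 = op_powr A \<mu> w" using source by (auto simp: source_condition_def A_def)
  show thesis
  proof (rule that[of "fact (2 * k) * norm w"])
    fix T :: real and z :: 'y assume T: "0 < T"
    have "norm (op_sech A T (u0 - u)) = norm (op_sech A T (op_powr A \<mu> w))"
      unfolding w[symmetric] by (simp add: blinfun.diff_right norm_minus_commute)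
    also have "\<dots> \<le> fact (2 * k) * T powr (- 2 * \<mu>) * norm w"
      by (rule norm_op_sech_powr_le[OF A \<mu> k T])
    \<comment> \<open>For the exact data F u the normal equation is reflexivity.\<close>
    finally show "norm (riccati_reg F u0 T z - u) \<le> fact (2 * k) * norm w * T powr (- 2 * \<mu>) + norm (F u - z) * T"
      using riccati_reg_error[OF T refl, where u = u and ?u0.0 = u0 and z = z] by (simp add: A_def norm_minus_commute mult_ac)
  qed simp
qed

end

(* The initial guess u0 is arbitrary. Since the error for exact data is
   R_T(F u) - u = cosh(T sqrt(F^* F))^{-1} (u0 - u), smoothness has to be imposed on u - u0
   (on u itself if u0 = 0), and convergence to the minimum norm solution needs u0 to have
   no component in the null space of F. *)
theorem theorem3p1:
  fixes F :: "'x::{real_inner,complete_space} \<Rightarrow>\<^sub>L 'y::{real_inner,complete_space}"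
    and u0 :: 'x
  shows "(u0 \<in> {x. F x = 0}\<^sup>\<bottom> \<longrightarrow> regularization_operator F (riccati_reg F u0)) \<and>
    (\<forall>\<mu>>0. \<forall>udag. source_condition F \<mu> (udag - u0) \<longrightarrow>
      (\<exists>C.
        (\<forall>T>0. norm (riccati_reg F u0 T (F udag) - udag) \<le> C * T powr (- 2 * \<mu>)) \<and>
        (\<forall>T>0. \<forall>\<delta> y\<delta>. norm (F udag - y\<delta>) \<le> \<delta> \<longrightarrow>
           norm (riccati_reg F u0 T y\<delta> - udag) \<le> C * T powr (- 2 * \<mu>) + \<delta> * T)) \<and>
      (\<forall>(T :: real \<Rightarrow> real) c1 c2. c1 > 0 \<longrightarrow> c2 > 0 \<longrightarrow>
        (\<forall>\<^sub>F \<delta> in at_right 0. c1 * \<delta> powr (- 1 / (2 * \<mu> + 1)) \<le> T \<delta> \<and>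
                              T \<delta> \<le> c2 * \<delta> powr (- 1 / (2 * \<mu> + 1))) \<longrightarrow>
        (\<exists>K. \<forall>\<^sub>F \<delta> in at_right 0. \<forall>y\<delta>. norm (F udag - y\<delta>) \<le> \<delta> \<longrightarrow>
           norm (riccati_reg F u0 (T \<delta>) y\<delta> - udag) \<le> K * \<delta> powr (2 * \<mu> / (2 * \<mu> + 1)))))"
proof (intro conjI impI allI)
  show "regularization_operator F (riccati_reg F u0)" if "u0 \<in> {x. F x = 0}\<^sup>\<bottom>"
    using that by (rule riccati_reg_regularization)
next
  fix \<mu> :: real and u :: 'x
  assume \<mu>: "0 < \<mu>" and source: "source_condition F \<mu> (u - u0)"
  obtain C where C: "0 \<le> C"
    "\<And>T z. 0 < T \<Longrightarrow> norm (riccati_reg F u0 T z - u) \<le> C * T powr (- 2 * \<mu>) + norm (F u - z) * T"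
    by (rule riccati_reg_rate[OF \<mu> source]) blast
  have noisy: "norm (riccati_reg F u0 T z - u) \<le> C * T powr (- 2 * \<mu>) + \<delta> * T"
    if "0 < T" "norm (F u - z) \<le> \<delta>" for T z \<delta>
    using C(2)[OF that(1), of z] mult_right_mono[OF that(2), of T] that(1) by linarith
  show "\<exists>C. (\<forall>T>0. norm (riccati_reg F u0 T (F u) - u) \<le> C * T powr (- 2 * \<mu>)) \<and>
      (\<forall>T>0. \<forall>\<delta> y\<delta>. norm (F u - y\<delta>) \<le> \<delta> \<longrightarrow>
         norm (riccati_reg F u0 T y\<delta> - u) \<le> C * T powr (- 2 * \<mu>) + \<delta> * T)"
    using C(2)[of _ "F u"] noisy by (intro exI[of _ C]) auto
  fix T :: "real \<Rightarrow> real" and c1 c2 :: real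
  assume c: "0 < c1" "0 < c2" and T: "\<forall>\<^sub>F \<delta> in at_right 0. c1 * \<delta> powr (- 1 / (2 * \<mu> + 1)) \<le> T \<delta> \<and>
    T \<delta> \<le> c2 * \<delta> powr (- 1 / (2 * \<mu> + 1))"
  have pos: "\<forall>\<^sub>F \<delta> in at_right (0::real). 0 < \<delta>" by (simp add: eventually_at_right_less)
  show "\<exists>K. \<forall>\<^sub>F \<delta> in at_right 0. \<forall>y\<delta>. norm (F u - y\<delta>) \<le> \<delta> \<longrightarrow>
      norm (riccati_reg F u0 (T \<delta>) y\<delta> - u) \<le> K * \<delta> powr (2 * \<mu> / (2 * \<mu> + 1))"
  proof (intro exI)
    show "\<forall>\<^sub>F \<delta> in at_right 0. \<forall>y\<delta>. norm (F u - y\<delta>) \<le> \<delta> \<longrightarrow>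
        norm (riccati_reg F u0 (T \<delta>) y\<delta> - u)
          \<le> (C * c1 powr (- 2 * \<mu>) + c2) * \<delta> powr (2 * \<mu> / (2 * \<mu> + 1))"
      using T pos
    proof eventually_elim
      case (elim \<delta>)
      define r where "r = \<delta> powr (- 1 / (2 * \<mu> + 1))"
      have r: "0 < r" "c1 * r \<le> T \<delta>" "T \<delta> \<le> c2 * r" using elim by (auto simp: r_def)
      have Tpos: "0 < T \<delta>" using r c by (meson less_le_trans mult_pos_pos)
      \<comment> \<open>The exponent is negative, so the lower bound on T controls the bias; the
        upper bound controls the noise.\<close>
      have "T \<delta> powr (- 2 * \<mu>) \<le> (c1 * r) powr (- 2 * \<mu>)"
        using r c \<mu> by (intro powr_mono2') auto
      also have "\<dots> = c1 powr (- 2 * \<mu>) * r powr (- 2 * \<mu>)" using r c by (simp add: powr_mult)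
      also have "r powr (- 2 * \<mu>) = \<delta> powr (2 * \<mu> / (2 * \<mu> + 1))" by (simp add: r_def powr_powr)
      finally have bias: "C * T \<delta> powr (- 2 * \<mu>) \<le> C * c1 powr (- 2 * \<mu>) * \<delta> powr (2 * \<mu> / (2 * \<mu> + 1))"
        using C(1) by (simp add: mult_left_mono mult.assoc)
      have "\<delta> * T \<delta> \<le> \<delta> * (c2 * r)" using r elim by (intro mult_left_mono) auto
      also have "\<delta> * (c2 * r) = c2 * (\<delta> powr 1 * \<delta> powr (- 1 / (2 * \<mu> + 1)))"
        using elim by (simp add: r_def)
      \<comment> \<open>The choice of T balances the terms: 1 - 1 / (2 \<mu> + 1) equals the bias
        exponent 2 \<mu> / (2 \<mu> + 1).\<close>
      also have "\<delta> powr 1 * \<delta> powr (- 1 / (2 * \<mu> + 1)) = \<delta> powr (2 * \<mu> / (2 * \<mu> + 1))"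
        unfolding powr_add[symmetric] using \<mu> by (intro arg_cong[where f = "\<lambda>a. \<delta> powr a"]) (simp add: field_simps)
      finally have noise: "\<delta> * T \<delta> \<le> c2 * \<delta> powr (2 * \<mu> / (2 * \<mu> + 1))" .
      show ?case
      proof (intro allI impI)
        fix z assume "norm (F u - z) \<le> \<delta>"
        from noisy[OF Tpos this] bias noise
        show "norm (riccati_reg F u0 (T \<delta>) z - u)
            \<le> (C * c1 powr (- 2 * \<mu>) + c2) * \<delta> powr (2 * \<mu> / (2 * \<mu> + 1))"
          by (simp add: distrib_right)
      qed
    qed
  qed
qed

end
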